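(* Let $\Omega=\Omega_1\sqcup\dots\sqcup\Omega_\psi$ be a finite set with $\#\Omega_j=m_j$, $N=\#\Omega=\sum_j m_j$, let $S_N$ be the group of all permutations of $\Omega$, and let $Y=Y(\{m_j\})=S_{m_1}\times\dots\times S_{m_\psi}\subset S_N$ be the Young subgroup of permutations preserving each $\Omega_j$. For a neck mess $\theta$ having exactly $m_j$ beads of color $j$ for each $j$, let $\Gamma[\theta]\subset S_N$ be the corresponding $Y$-conjugacy class and let $\gamma[\theta]=\sum_{p\in\Gamma[\theta]}p$, an element of the subalgebra $\mathbb{C}[S_N/\!/Y]\subset\mathbb{C}[S_N]$ of functions constant on $Y$-conjugacy classes. Then for all neck messes $\lambda,\mu$ having $m_j$ beads of color $j$ for each $j$, $$\gamma[\mu]\cdot\gamma[\lambda]=\sum_{\nu\in S_N/\!/Y} c_{\mu\lambda}^{\nu}\,\gamma[\nu],$$ where elements $\nu\in S_N/\!/Y$ are identified with isomorphism classes of neck messes having $m_j$ beads of color $j$ for each $j$, and the structure constants are given by the "colored Hurwitz numbers" $$c_{\mu\lambda}^{\nu}=\bigl(\#\operatorname{Aut}(\nu)\bigr)\sum_{\mathcal H^\circ\in\mathcal K_{\{m_j\}}[\lambda,\mu,\nu]}\frac{1}{\#\operatorname{Aut}(\mathcal H^\circ)}.$$ Here $\mathcal K_{\{m_j\}}[\lambda,\mu,\nu]$ is the set of all colored checker triangulated surfaces (up to combinatorial equivalence) whose nearIR-farUV, midIR-farUV and plus-nearIR-midIR neck messes are $\lambda$, $\mu$, $\nu$ respecti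vely.
   Context: Product of permutations: $vu$ means first apply $u$, then $v$; the product in $\mathbb C[S_N]$ is the usual group algebra product. Elements of $\Omega_j$ are said to have color $j$, $j=1,\dots,\psi$. Conjugacy classes: $S_N/\!/Y$ denotes the set of equivalence classes of $S_N$ under $g\sim hgh^{-1}$, $h\in Y$ ($Y$-conjugacy classes). Necklaces and neck messes: a necklace of length $\ell$ is a cyclic collection of $\ell$ beads, each of one of the $\psi$ colors, defined up to cyclic permutation (reflections are not allowed). An isomorphism of necklaces is a bijection of beads preserving colors and cyclic order. A neck mess is a finite collection (multiset) of necklaces; an isomorphism of neck messes $\{p_1,\dots,p_k\}\to\{q_1,\dots,q_k\}$ is a permutation $\sigma\in S_k$ together with isomorphisms of necklaces $p_i\to q_{\sigma(i)}$. $\operatorname{Aut}(\theta)$ is the group of automorphisms of a neck mess $\theta$: if $\theta$ consists of $\alpha_l$ copies of pairwise nonisomorphic necklaces $r_l$, it is $\prod_l\bigl(S_{\alpha_l}\ltimes \operatorname{Aut}(r_l)^{\alpha_l}\bigr)$. Neck messes are considered up to isomorphism. The neck mess of $g\in S_N$ is obtained by decomposing $g$ into disjoint cycles $(a\to g(a)\to g^2(a)\to\cdots)$ (fixed points included) and replacing each element by its color. $\Gamma[\theta]$ is the set of all $g\in S_N$ with neck mess $\theta$; this gives a bijection between $S_N/\!/Y$ and isomorphism classes of neck messes having $m_j$ beads of color $j$ for each $j$. Checker triangulated surfaces: a checker triangulated surface is a colored graph on an oriented, not necessarily connected, closed surface such that the edges are painted in 3 colors, nearIR, midIR, farUV; the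 graph divides the surface into triangles, each having one edge of each color, of two mirror types: plus-triangles, in which the edges nearIR, midIR, farUV follow in this order counterclockwise along the boundary, and minus-triangles, in which they follow in this order clockwise; all neighbors of plus-triangles are minus-triangles and vice versa. Consequently, the edges at each vertex have two alternating colors, and each vertex has a type: nearIR-farUV, midIR-farUV or nearIR-midIR. A chamber is the quadrilateral obtained as the union of two triangles (a plus-triangle and a minus-triangle) having a common farUV edge; a surface with $2N$ triangles has $N$ chambers. A colored checker triangulated surface (for $\{m_j\}$) is a checker triangulated surface with $2N$ triangles whose chambers are painted in colors $1,\dots,\psi$ so that exactly $m_j$ chambers have color $j$. Such surfaces are considered up to combinatorial equivalence (orientation-preserving, preserving the graph, the colors of edges and the colors of chambers). $\operatorname{Aut}(\mathcal H^\circ)$ is the finite group of combinatorial automorphisms of the colored surface $\mathcal H^\circ$. Neck messes of a colored surface: (i) the nearIR-farUV neck mess: at each nearIR-farUV vertex take the necklace of colors of the chambers around the vertex in counterclockwise order; (ii) the midIR-farUV neck mess: at each midIR-farUV vertex take the necklace of colors of the chambers around the vertex in clockwise order; (iii) the plus-nearIR-midIR neck mess: at each nearIR-midIR vertex take, in counterclockwise order, the necklace of colors of the chambers containing the plus-triangles around the vertex.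
   Formalization: The nearIR-farUV necklaces are read clockwise instead of counterclockwise; as printed the formula fails, e.g. for m=(1,1,1), λ=μ=(1 2 3), where the product is (1 3 2) but the surfaces give the identity. *)

theory Defs
  imports Complex_Main "HOL-Combinatorics.Combinatorics" "HOL-Library.FuncSet"
    "HOL-Library.Disjoint_Sets"
begin

section \<open>Necklaces and neck messes\<close>

quotient_type 'c necklace =
  "'c list" / partial: "\<lambda>xs ys. xs \<noteq> [] \<and> (\<exists>n. ys = rotate n xs)"
proof (rule part_equivpI)
  show "\<exists>xs::'c list. xs \<noteq> [] \<and> (\<exists>n. xs = rotate n xs)"
    by (rule exI[of _ "[undefined]"]) (auto intro: exI[of _ 0])
  show "symp (\<lambda>xs ys::'c list. xs \<noteq> [] \<and> (\<exists>n. ys = rotate n xs))"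
  proof (rule sympI)
    fix xs ys :: "'c list"
    assume "xs \<noteq> [] \<and> (\<exists>n. ys = rotate n xs)"
    then obtain n where n: "xs \<noteq> []" "ys = rotate n xs" by blast
    have "rotate (length xs - n mod length xs) ys
        = rotate (length xs - n mod length xs) (rotate (n mod length xs) xs)"
      using n(2) rotate_conv_mod by metis
    also have "\<dots> = rotate (length xs) xs"
      using n(1) by (simp add: rotate_rotate)
    also have "\<dots> = xs" by simp
    finally show "ys \<noteq> [] \<and> (\<exists>k. xs = rotate k ys)"
      using n by (metis rotate_is_Nil_conv)
  qed
  show "transp (\<lambda>xs ys::'c list. xs \<noteq> [] \<and> (\<exists>n. ys = rotate n xs))"
    by (rule transpI) (auto simp: rotate_rotate)
qed

lift_definition necklace_beads :: "'c necklace \<Rightarrow> 'c multiset" is mset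
  by (auto simp: rotate_drop_take simp flip: mset_append)
    (metis append_take_drop_id mset_append union_commute)

type_synonym neck_mess = "nat necklace multiset"

definition beads :: "neck_mess \<Rightarrow> nat multiset" where
  "beads \<theta> = (\<Sum>r\<in>#\<theta>. necklace_beads r)"

definition neck_messes :: "nat \<Rightarrow> (nat \<Rightarrow> nat) \<Rightarrow> neck_mess set" where
  "neck_messes \<psi> m =
     {\<theta>. set_mset (beads \<theta>) \<subseteq> {1..\<psi>} \<and> (\<forall>j\<in>{1..\<psi>}. count (beads \<theta>) j = m j)}"

text \<open>The beads of a necklace, cut open to a list, are the positions of that list.\<close>

definition necklace_isos :: "'c list \<Rightarrow> 'c list \<Rightarrow> (nat \<Rightarrow> nat) set" where
  "necklace_isos xs ys =
     {f \<in> {..<length xs} \<rightarrow>\<^sub>E {..<length ys}.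
        bij_betw f {..<length xs} {..<length ys} \<and>
        (\<forall>i<length xs. ys ! f i = xs ! i) \<and>
        (\<forall>i<length xs. f (Suc i mod length xs) = Suc (f i) mod length ys)}"

text \<open>The choice of an enumeration of the necklaces of \<open>\<theta>\<close>, and of
  a starting bead on each, affects this group only up to isomorphism.\<close>

definition neck_mess_auts :: "neck_mess \<Rightarrow> ((nat \<Rightarrow> nat) \<times> (nat \<Rightarrow> nat \<Rightarrow> nat)) set" where
  "neck_mess_auts \<theta> =
     (let ps = map rep_necklace (SOME qs. mset qs = \<theta>)
      in SIGMA \<sigma>:{\<sigma>. \<sigma> permutes {..<length ps}}.
           \<Pi>\<^sub>E i\<in>{..<length ps}. necklace_isos (ps ! i) (ps ! \<sigma> i))"


section \<open>Conjugacy classes with respect to a Young subgroup\<close>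

definition total :: "(nat \<Rightarrow> 'a set) \<Rightarrow> nat \<Rightarrow> 'a set" where
  "total \<Omega> \<psi> = (\<Union>j\<in>{1..\<psi>}. \<Omega> j)"

definition color_of :: "(nat \<Rightarrow> 'a set) \<Rightarrow> nat \<Rightarrow> 'a \<Rightarrow> nat" where
  "color_of \<Omega> \<psi> x = (THE j. j \<in> {1..\<psi>} \<and> x \<in> \<Omega> j)"

definition symmetric :: "(nat \<Rightarrow> 'a set) \<Rightarrow> nat \<Rightarrow> ('a \<Rightarrow> 'a) set" where
  "symmetric \<Omega> \<psi> = {g. g permutes total \<Omega> \<psi>}"

definition young :: "(nat \<Rightarrow> 'a set) \<Rightarrow> nat \<Rightarrow> ('a \<Rightarrow> 'a) set" where
  "young \<Omega> \<psi> = {h \<in> symmetric \<Omega> \<psi>. \<forall>j\<in>{1..\<psi>}. h ` \<Omega> j = \<Omega> j}"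

definition young_classes :: "(nat \<Rightarrow> 'a set) \<Rightarrow> nat \<Rightarrow> ('a \<Rightarrow> 'a) set set" where
  "young_classes \<Omega> \<psi> =
     symmetric \<Omega> \<psi> //
       {(g, h \<circ> g \<circ> inv h) | g h. g \<in> symmetric \<Omega> \<psi> \<and> h \<in> young \<Omega> \<psi>}"

text \<open>For \<open>a\<close> in the cycle \<open>Z\<close> of \<open>g\<close>, \<^term>\<open>support g a\<close> is the list
  \<open>[a, g a, g (g a), \<dots>]\<close> of the elements of \<open>Z\<close>.\<close>

definition perm_neck_mess :: "(nat \<Rightarrow> 'a set) \<Rightarrow> nat \<Rightarrow> ('a \<Rightarrow> 'a) \<Rightarrow> neck_mess" where
  "perm_neck_mess \<Omega> \<psi> g =
     image_mset (\<lambda>Z. abs_necklace (map (color_of \<Omega> \<psi>) (support g (SOME a. a \<in> Z))))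
       (mset_set (orbit g ` total \<Omega> \<psi>))"

definition Gamma :: "(nat \<Rightarrow> 'a set) \<Rightarrow> nat \<Rightarrow> neck_mess \<Rightarrow> ('a \<Rightarrow> 'a) set" where
  "Gamma \<Omega> \<psi> \<theta> = {g \<in> symmetric \<Omega> \<psi>. perm_neck_mess \<Omega> \<psi> g = \<theta>}"

text \<open>The identification of Young conjugacy classes with neck messes.\<close>

definition class_neck_mess :: "(nat \<Rightarrow> 'a set) \<Rightarrow> nat \<Rightarrow> ('a \<Rightarrow> 'a) set \<Rightarrow> neck_mess" where
  "class_neck_mess \<Omega> \<psi> C = (THE \<theta>. \<forall>g\<in>C. perm_neck_mess \<Omega> \<psi> g = \<theta>)"

text \<open>The group algebra consists of complex functions vanishing off the symmetric group. In
  \<open>p \<circ> q\<close> the permutation \<open>q\<close> is applied first.\<close>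

definition convolution ::
  "(nat \<Rightarrow> 'a set) \<Rightarrow> nat \<Rightarrow> (('a \<Rightarrow> 'a) \<Rightarrow> complex) \<Rightarrow> (('a \<Rightarrow> 'a) \<Rightarrow> complex)
     \<Rightarrow> ('a \<Rightarrow> 'a) \<Rightarrow> complex" where
  "convolution \<Omega> \<psi> f f' =
     (\<lambda>g. \<Sum>(p, q) | p \<in> symmetric \<Omega> \<psi> \<and> q \<in> symmetric \<Omega> \<psi> \<and> p \<circ> q = g. f p * f' q)"

definition gamma :: "(nat \<Rightarrow> 'a set) \<Rightarrow> nat \<Rightarrow> neck_mess \<Rightarrow> ('a \<Rightarrow> 'a) \<Rightarrow> complex" where
  "gamma \<Omega> \<psi> \<theta> = (\<lambda>g. of_bool (g \<in> Gamma \<Omega> \<psi> \<theta>))"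


section \<open>Colored checker triangulated surfaces\<close>

text \<open>
  A graph cutting an oriented closed, possibly disconnected, surface into polygons is encoded by
  its combinatorial map. A dart is an edge with a direction, thought of as emanating from its
  initial vertex; \<open>flip\<close> reverses a dart and \<open>rot\<close> sends a dart to the next dart
  counterclockwise around the same vertex. Vertices are the cycles of \<open>rot\<close>, edges those of
  \<open>flip\<close>. The face of a dart is the one on its left; the dart that follows \<open>d\<close>
  counterclockwise along the boundary of this face is the clockwise neighbor of \<open>flip d\<close>.
\<close>

datatype edge_color = NearIR | MidIR | FarUV

record 'd surface =
  darts :: "'d set"
  rot :: "'d \<Rightarrow> 'd"
  flip :: "'d \<Rightarrow> 'd"
  edge_color :: "'d \<Rightarrow> edge_color"
  chamber_color :: "'d set \<Rightarrow> nat"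

definition face_next :: "'d surface \<Rightarrow> 'd \<Rightarrow> 'd" where
  "face_next H = inv (rot H) \<circ> flip H"

definition face :: "'d surface \<Rightarrow> 'd \<Rightarrow> 'd set" where
  "face H d = orbit (face_next H) d"

definition faces :: "'d surface \<Rightarrow> 'd set set" where
  "faces H = face H ` darts H"

definition vertices :: "'d surface \<Rightarrow> 'd set set" where
  "vertices H = orbit (rot H) ` darts H"

fun next_color :: "edge_color \<Rightarrow> edge_color" where
  "next_color NearIR = MidIR"
| "next_color MidIR = FarUV"
| "next_color FarUV = NearIR"

definition plus_triangle :: "'d surface \<Rightarrow> 'd set \<Rightarrow> bool" where
  "plus_triangle H T \<longleftrightarrow> card T = 3 \<and> edge_color H ` T = UNIV \<and>
     (\<forall>d\<in>T. edge_color H (face_next H d) = next_color (edge_color H d))"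

definition minus_triangle :: "'d surface \<Rightarrow> 'd set \<Rightarrow> bool" where
  "minus_triangle H T \<longleftrightarrow> card T = 3 \<and> edge_color H ` T = UNIV \<and>
     (\<forall>d\<in>T. edge_color H d = next_color (edge_color H (face_next H d)))"

definition checker_surface :: "'d surface \<Rightarrow> bool" where
  "checker_surface H \<longleftrightarrow>
     finite (darts H) \<and> rot H permutes darts H \<and> flip H permutes darts H \<and>
     (\<forall>d\<in>darts H. flip H d \<noteq> d \<and> flip H (flip H d) = d) \<and>
     (\<forall>d\<in>darts H. edge_color H (flip H d) = edge_color H d) \<and>
     (\<forall>T\<in>faces H. plus_triangle H T \<or> minus_triangle H T) \<and>
     (\<forall>d\<in>darts H. plus_triangle H (face H d) \<longleftrightarrow> minus_triangle H (face H (flip H d)))"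

text \<open>A chamber is represented by the set of the six darts on the boundaries of its two triangles
  (the two directions of the common edge included).\<close>

definition chambers :: "'d surface \<Rightarrow> 'd set set" where
  "chambers H = {face H d \<union> face H (flip H d) | d. d \<in> darts H \<and> edge_color H d = FarUV}"

definition chamber_of :: "'d surface \<Rightarrow> 'd \<Rightarrow> 'd set" where
  "chamber_of H d = (THE C. C \<in> chambers H \<and> d \<in> C)"

definition colored_checker_surface :: "nat \<Rightarrow> (nat \<Rightarrow> nat) \<Rightarrow> 'd surface \<Rightarrow> bool" where
  "colored_checker_surface \<psi> m H \<longleftrightarrow>
     checker_surface H \<and> card (faces H) = 2 * (\<Sum>j=1..\<psi>. m j) \<and>
     chamber_color H ` chambers H \<subseteq> {1..\<psi>} \<and>
     (\<forall>j\<in>{1..\<psi>}. card {C \<in> chambers H. chamber_color H C = j} = m j)"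

definition surface_isos :: "'d surface \<Rightarrow> 'e surface \<Rightarrow> ('d \<Rightarrow> 'e) set" where
  "surface_isos H H' =
     {h \<in> darts H \<rightarrow>\<^sub>E darts H'.
        bij_betw h (darts H) (darts H') \<and>
        (\<forall>d\<in>darts H. h (rot H d) = rot H' (h d)) \<and>
        (\<forall>d\<in>darts H. h (flip H d) = flip H' (h d)) \<and>
        (\<forall>d\<in>darts H. edge_color H' (h d) = edge_color H d) \<and>
        (\<forall>C\<in>chambers H. chamber_color H' (h ` C) = chamber_color H C)}"

abbreviation surface_auts :: "'d surface \<Rightarrow> ('d \<Rightarrow> 'd) set" where
  "surface_auts H \<equiv> surface_isos H H"

definition vertices_of_type :: "'d surface \<Rightarrow> edge_color \<Rightarrow> edge_color \<Rightarrow> 'd set set" where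
  "vertices_of_type H a b = {V \<in> vertices H. edge_color H ` V = {a, b}}"

text \<open>Go around the vertex \<open>V\<close> in the direction \<open>r\<close> (\<open>rot H\<close> for counterclockwise,
  \<open>inv (rot H)\<close> for clockwise), and write down the color of the chamber to the left of each
  dart satisfying \<open>P\<close>.\<close>

definition vertex_necklace ::
  "'d surface \<Rightarrow> ('d \<Rightarrow> 'd) \<Rightarrow> ('d \<Rightarrow> bool) \<Rightarrow> 'd set \<Rightarrow> nat necklace" where
  "vertex_necklace H r P V =
     abs_necklace (map (\<lambda>d. chamber_color H (chamber_of H d))
       (filter P (support r (SOME d. d \<in> V))))"

text \<open>
  At a vertex lying on \<open>FarUV\<close> edges, the chambers around the vertex correspond to the
  \<open>FarUV\<close> darts emanating from it.

  Both \<open>near_far_neck_mess\<close> and \<open>mid_far_neck_mess\<close> are read clockwise; this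
  departs from the source, where the first is read counterclockwise and the second clockwise. With
  opposite directions the multiplication formula fails: take three chambers of
  distinct colors 1, 2, 3 forming a sphere, each chamber being a lune with its \<open>FarUV\<close> edge
  going from pole to pole. All three \<open>NearIR\<close>-\<open>MidIR\<close> vertices then have degree 2,
  so the third neck mess is that of the identity. Viewed from outside, opposite directions around
  the two poles give the same necklace (1 2 3) twice, although the square of a 3-cycle is
  not the identity; the same direction gives (1 2 3) and (1 3 2), as it must be.
\<close>

definition near_far_neck_mess :: "'d surface \<Rightarrow> neck_mess" where
  "near_far_neck_mess H =
     image_mset (vertex_necklace H (inv (rot H)) (\<lambda>d. edge_color H d = FarUV))
       (mset_set (vertices_of_type H NearIR FarUV))"

definition mid_far_neck_mess :: "'d surface \<Rightarrow> neck_mess" where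
  "mid_far_neck_mess H =
     image_mset (vertex_necklace H (inv (rot H)) (\<lambda>d. edge_color H d = FarUV))
       (mset_set (vertices_of_type H MidIR FarUV))"

definition plus_near_mid_neck_mess :: "'d surface \<Rightarrow> neck_mess" where
  "plus_near_mid_neck_mess H =
     image_mset (vertex_necklace H (rot H) (\<lambda>d. plus_triangle H (face H d)))
       (mset_set (vertices_of_type H NearIR MidIR))"

text \<open>Every finite surface is combinatorially equivalent to one whose darts are natural numbers.\<close>

definition surfaces_with ::
  "nat \<Rightarrow> (nat \<Rightarrow> nat) \<Rightarrow> neck_mess \<Rightarrow> neck_mess \<Rightarrow> neck_mess \<Rightarrow> nat surface set" where
  "surfaces_with \<psi> m lam \<mu> \<nu> =
     {H. colored_checker_surface \<psi> m H \<and> near_far_neck_mess H = lam \<and>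
         mid_far_neck_mess H = \<mu> \<and> plus_near_mid_neck_mess H = \<nu>}"

definition surface_classes ::
  "nat \<Rightarrow> (nat \<Rightarrow> nat) \<Rightarrow> neck_mess \<Rightarrow> neck_mess \<Rightarrow> neck_mess \<Rightarrow> nat surface set set" where
  "surface_classes \<psi> m lam \<mu> \<nu> =
     surfaces_with \<psi> m lam \<mu> \<nu> //
       {(H, H'). H \<in> surfaces_with \<psi> m lam \<mu> \<nu> \<and> H' \<in> surfaces_with \<psi> m lam \<mu> \<nu> \<and>
                 surface_isos H H' \<noteq> {}}"

definition hurwitz ::
  "nat \<Rightarrow> (nat \<Rightarrow> nat) \<Rightarrow> neck_mess \<Rightarrow> neck_mess \<Rightarrow> neck_mess \<Rightarrow> complex" where
  "hurwitz \<psi> m \<mu> lam \<nu> =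
     of_nat (card (neck_mess_auts \<nu>)) *
       (\<Sum>K\<in>surface_classes \<psi> m lam \<mu> \<nu>. 1 / of_nat (card (surface_auts (SOME H. H \<in> K))))"

end

theory Submission
  imports Defs
begin

text \<open>
  The coefficient of a permutation \<open>g\<close> in the product is the number of factorizations
  \<open>g = p \<circ> q\<close> with \<open>p\<close> of neck mess \<open>\<mu>\<close> and \<open>q\<close> of neck mess \<open>\<lambda>\<close>. The theorem says
  that these are counted by surfaces, and it rests on two facts.

  The first one: a colored checker triangulated surface is the same thing as a finite colored set, its set
  of chambers, with an arbitrary pair of permutations. Indeed, a surface is glued from chambers.
  Let the \<open>NearIR\<close> side of the plus-triangle of a chamber \<open>e\<close> be glued to the
  chamber \<open>q e\<close>, and the \<open>MidIR\<close> side of its minus-triangle to the chamber \<open>p e\<close>.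
  The permutations \<open>p\<close> and \<open>q\<close> determine the surface and can be prescribed. Rotating around the
  vertices, one crosses these edges, and sees that the chambers around the vertices of the three
  types are the cycles of \<open>q\<close>, of \<open>p\<close>, and of \<open>p \<circ> q\<close>. So the three neck messes of
  the surface are those of \<open>q\<close>, \<open>p\<close> and \<open>p \<circ> q\<close>. A labelling of the chambers with
  this gluing pattern is expressed by the locale \<open>surface_chart\<close>; the lemmas \<open>exists_chart\<close>,
  \<open>exists_surface\<close> and \<open>bij_betw_chart_map\<close> establish the correspondence for objects and
  isomorphisms.

  The second one: a permutation of a colored set is determined by its neck mess \<open>\<nu>\<close> up to a
  color preserving isomorphism, and there are \<open>#Aut(\<nu>)\<close> isomorphisms between two
  permutations with this neck mess (\<open>card_perm_isos\<close>). In particular, the Young conjugacy classes are the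
  fibers of the neck mess (\<open>young_conjugacy_iff\<close>).

  Let now \<open>g\<close> have the neck mess \<open>\<nu>\<close>, and let \<open>H\<close> be a surface with the neck messes \<open>\<lambda>\<close>,
  \<open>\<mu>\<close>, \<open>\<nu>\<close>, given by permutations \<open>p0\<close> and \<open>q0\<close> of its chambers. There are \<open>#Aut(\<nu>)\<close>
  color preserving bijections from \<open>\<Omega>\<close> to the set of chambers that carry \<open>g\<close> to
  \<open>p0 \<circ> q0\<close>. Each of them pulls \<open>p0\<close> and \<open>q0\<close> back to a factorization of \<open>g\<close>, and two of them
  give the same factorization if and only if they differ by an automorphism of \<open>H\<close>. So
  \<open>#Aut(\<nu>) / #Aut(H)\<close> factorizations come from \<open>H\<close> (\<open>card_surface_factorizations\<close>). Each
  factorization comes from exactly one \<open>H\<close>, and summation over \<open>H\<close> gives the formula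
  (\<open>card_factorizations_eq_hurwitz\<close>).
\<close>

section \<open>Colored permutations\<close>

text \<open>
  A colored permutation is a set \<open>A\<close> with a coloring \<open>c\<close> and a permutation \<open>g\<close>. Its
  isomorphisms are extensional functions, so that they can be counted.
\<close>
definition perm_isos ::
  "'a set \<Rightarrow> ('a \<Rightarrow> 'c) \<Rightarrow> ('a \<Rightarrow> 'a) \<Rightarrow> 'b set \<Rightarrow> ('b \<Rightarrow> 'c) \<Rightarrow> ('b \<Rightarrow> 'b) \<Rightarrow> ('a \<Rightarrow> 'b) set"
where
  "perm_isos A c g B d h =
     {f \<in> A \<rightarrow>\<^sub>E B. bij_betw f A B \<and> (\<forall>x\<in>A. d (f x) = c x) \<and> (\<forall>x\<in>A. f (g x) = h (f x))}"

lemma perm_isos_compose: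
  assumes "f \<in> perm_isos A c g A' c' g'" and "k \<in> perm_isos A' c' g' A'' c'' g''"
    and "\<And>x. x \<in> A \<Longrightarrow> g x \<in> A"
  shows "compose A k f \<in> perm_isos A c g A'' c'' g''"
proof -
  have f: "f \<in> A \<rightarrow>\<^sub>E A'" "bij_betw f A A'" "\<forall>x\<in>A. c' (f x) = c x" "\<forall>x\<in>A. f (g x) = g' (f x)"
    and k: "k \<in> A' \<rightarrow>\<^sub>E A''" "bij_betw k A' A''" "\<forall>x\<in>A'. c'' (k x) = c' x"
      "\<forall>x\<in>A'. k (g' x) = g'' (k x)"
    using assms by (simp_all add: perm_isos_def)
  have fA: "f x \<in> A'" if "x \<in> A" for x using f(1) that by auto
  show ?thesis
    unfolding perm_isos_def
    using f k fA assms(3) bij_betw_compose[OF f(2) k(2)]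
    by (auto simp: compose_def)
qed

lemma perm_isos_inverse:
  assumes f: "f \<in> perm_isos A c g A' c' g'" and g: "\<And>x. x \<in> A \<Longrightarrow> g x \<in> A"
  shows "restrict (inv_into A f) A' \<in> perm_isos A' c' g' A c g"
proof -
  have f: "f \<in> A \<rightarrow>\<^sub>E A'" "bij_betw f A A'" "\<forall>x\<in>A. c' (f x) = c x" "\<forall>x\<in>A. f (g x) = g' (f x)"
    using f by (simp_all add: perm_isos_def)
  have inv: "inv_into A f y \<in> A" "f (inv_into A f y) = y" if "y \<in> A'" for y
    using that f(2) by (auto simp: bij_betw_def inv_into_into f_inv_into_f)
  have g': "g' y \<in> A'" if "y \<in> A'" for y
    using inv[OF that] f(1,4) g by (metis PiE_mem)
  have "inv_into A f (g' y) = g (inv_into A f y)" if y: "y \<in> A'" for y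
  proof -
    have "f (g (inv_into A f y)) = g' y" using inv[OF y] f(4) by simp
    thus ?thesis
      using f(2) g[OF inv(1)[OF y]] by (metis bij_betw_def inv_into_f_f)
  qed
  moreover have "c (inv_into A f y) = c' y" if "y \<in> A'" for y
    using inv[OF that] f(3) by metis
  ultimately show ?thesis
    using inv g' bij_betw_inv_into[OF f(2)]
    by (auto simp: perm_isos_def cong: bij_betw_cong)
qed

text \<open>
  Composing with a fixed isomorphism is invertible; hence, between isomorphic objects, the number of
  isomorphisms depends only on the isomorphism class of the source and of the target. The next
  two lemmas let one compute it on models.
\<close>
lemma card_perm_isos_source:
  assumes f: "f \<in> perm_isos A c g A' c' g'" and g: "\<And>x. x \<in> A \<Longrightarrow> g x \<in> A"
  shows "card (perm_isos A' c' g' B d h) = card (perm_isos A c g B d h)"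
proof -
  let ?r = "restrict (inv_into A f) A'"
  have r: "?r \<in> perm_isos A' c' g' A c g" by (rule perm_isos_inverse[OF f g])
  have fb: "bij_betw f A A'" "f \<in> A \<rightarrow>\<^sub>E A'" "\<forall>x\<in>A. f (g x) = g' (f x)"
    using f by (auto simp: perm_isos_def)
  have inv: "inv_into A f y \<in> A" "f (inv_into A f y) = y" if "y \<in> A'" for y
    using that fb(1) by (auto simp: bij_betw_def inv_into_into f_inv_into_f)
  have inv': "inv_into A f (f x) = x" "f x \<in> A'" if "x \<in> A" for x
    using that fb by (auto simp: bij_betw_def)
  have g': "g' y \<in> A'" if "y \<in> A'" for y
    using inv[OF that] fb g by (metis PiE_mem)
  have "bij_betw (\<lambda>k. compose A k f) (perm_isos A' c' g' B d h) (perm_isos A c g B d h)"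
  proof (rule bij_betw_byWitness[where f' = "\<lambda>k. compose A' k ?r"])
    show "\<forall>k\<in>perm_isos A' c' g' B d h. compose A' (compose A k f) ?r = k"
      using inv by (auto simp: perm_isos_def compose_def fun_eq_iff PiE_def extensional_def)
    show "\<forall>k\<in>perm_isos A c g B d h. compose A (compose A' k ?r) f = k"
      using inv' by (auto simp: perm_isos_def compose_def fun_eq_iff PiE_def extensional_def)
    show "(\<lambda>k. compose A k f) ` perm_isos A' c' g' B d h \<subseteq> perm_isos A c g B d h"
      using perm_isos_compose[OF f _ g] by auto
    show "(\<lambda>k. compose A' k ?r) ` perm_isos A c g B d h \<subseteq> perm_isos A' c' g' B d h"
      using perm_isos_compose[OF r _ g'] by auto
  qed
  thus ?thesis by (rule bij_betw_same_card)
qed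

lemma card_perm_isos_target:
  assumes f: "f \<in> perm_isos A c g A' c' g'" and g: "\<And>x. x \<in> A \<Longrightarrow> g x \<in> A"
    and h: "\<And>x. x \<in> B \<Longrightarrow> h x \<in> B"
  shows "card (perm_isos B d h A c g) = card (perm_isos B d h A' c' g')"
proof -
  let ?r = "restrict (inv_into A f) A'"
  have r: "?r \<in> perm_isos A' c' g' A c g" by (rule perm_isos_inverse[OF f g])
  have fb: "bij_betw f A A'" "f \<in> A \<rightarrow>\<^sub>E A'"
    using f by (auto simp: perm_isos_def)
  have inv: "inv_into A f y \<in> A" "f (inv_into A f y) = y" if "y \<in> A'" for y
    using that fb(1) by (auto simp: bij_betw_def inv_into_into f_inv_into_f)
  have inv': "inv_into A f (f x) = x" "f x \<in> A'" if "x \<in> A" for x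
    using that fb by (auto simp: bij_betw_def)
  have "bij_betw (\<lambda>k. compose B f k) (perm_isos B d h A c g) (perm_isos B d h A' c' g')"
  proof (rule bij_betw_byWitness[where f' = "\<lambda>k. compose B ?r k"])
    show "\<forall>k\<in>perm_isos B d h A c g. compose B ?r (compose B f k) = k"
      using inv' by (auto simp: perm_isos_def compose_def fun_eq_iff PiE_def extensional_def Pi_def)
    show "\<forall>k\<in>perm_isos B d h A' c' g'. compose B f (compose B ?r k) = k"
      using inv by (auto simp: perm_isos_def compose_def fun_eq_iff PiE_def extensional_def Pi_def)
    show "(\<lambda>k. compose B f k) ` perm_isos B d h A c g \<subseteq> perm_isos B d h A' c' g'"
      using perm_isos_compose[OF _ f h] by auto
    show "(\<lambda>k. compose B ?r k) ` perm_isos B d h A' c' g' \<subseteq> perm_isos B d h A c g"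
      using perm_isos_compose[OF _ r h] by auto
  qed
  thus ?thesis by (rule bij_betw_same_card)
qed

section \<open>The neck mess of a colored permutation\<close>

text \<open>
  Necklaces form a partial quotient, whose domain is the nonempty lists, so equality of
  necklaces is equality up to rotation for these lists only.
\<close>
lemma abs_necklace_eq_iff:
  assumes xs: "xs \<noteq> []" and ys: "ys \<noteq> []"
  shows "abs_necklace xs = abs_necklace ys \<longleftrightarrow> (\<exists>n. ys = rotate n xs)"
proof -
  have refl: "zs \<noteq> [] \<and> (\<exists>n. zs = rotate n zs)" if "zs \<noteq> []" for zs :: "'a list"
    using that by (auto intro: exI[of _ 0])
  show ?thesis
    using Quotient3_rel[OF Quotient3_necklace, of xs ys] refl[OF xs] refl[OF ys] xs
    by blast
qed

lemma rep_necklace_not_Nil: "rep_necklace q \<noteq> []"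
  using Quotient3_rep_reflp[OF Quotient3_necklace, of q] by blast

text \<open>This makes the necklace of a cycle independent of the starting point.\<close>
lemma support_funpow:
  assumes "permutation g"
  shows "support g ((g ^^ n) a) = rotate n (support g a)"
proof (induction n)
  case (Suc n)
  let ?b = "(g ^^ n) a"
  have L: "least_power g (g b) = least_power g b" for b
  proof -
    have "(g ^^ n) (g b) = g b \<longleftrightarrow> (g ^^ n) b = b" for n
      using permutation_bijective[OF assms]
      by (metis bij_is_inj funpow_swap1 inj_eq)
    thus ?thesis by (simp add: least_power_def)
  qed
  have "support g (g ?b) = rotate1 (support g ?b)"
  proof (rule nth_equalityI)
    fix i assume i: "i < length (support g (g ?b))"
    let ?l = "least_power g ?b"
    have "(g ^^ i) (g ?b) = (g ^^ (Suc i mod ?l)) ?b"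
      using funpow_mod_eq[OF least_power_of_permutation(1)[OF assms, of ?b], of "Suc i"]
      by (simp add: funpow_swap1)
    thus "support g (g ?b) ! i = rotate1 (support g ?b) ! i"
      using i L by (simp add: nth_rotate1)
  qed (simp add: L)
  thus ?case using Suc by simp
qed simp

definition cycle_necklace :: "('a \<Rightarrow> 'c) \<Rightarrow> ('a \<Rightarrow> 'a) \<Rightarrow> 'a \<Rightarrow> 'c necklace" where
  "cycle_necklace c g a = abs_necklace (map c (support g a))"

lemma support_not_Nil:
  assumes "permutation g"
  shows "support g a \<noteq> []"
  using least_power_of_permutation(2)[OF assms, of a] by simp

lemma cycle_necklace_orbit:
  assumes "permutation g" and "b \<in> orbit g a"
  shows "cycle_necklace c g b = cycle_necklace c g a"
proof -
  obtain n where b: "b = (g ^^ n) a" using assms(2) by (auto simp: orbit_altdef)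
  have "map c (support g b) = rotate n (map c (support g a))"
    unfolding b support_funpow[OF assms(1)] by (rule rotate_map[symmetric])
  thus ?thesis
    unfolding cycle_necklace_def
    using support_not_Nil[OF assms(1)] abs_necklace_eq_iff by (metis map_is_Nil_conv)
qed

definition cycle_neck_mess :: "'a set \<Rightarrow> ('a \<Rightarrow> 'c) \<Rightarrow> ('a \<Rightarrow> 'a) \<Rightarrow> 'c necklace multiset" where
  "cycle_neck_mess A c g =
     image_mset (\<lambda>Z. cycle_necklace c g (SOME a. a \<in> Z)) (mset_set (orbit g ` A))"

lemma cycle_necklace_some:
  assumes "permutation g"
  shows "cycle_necklace c g (SOME b. b \<in> orbit g a) = cycle_necklace c g a"
  by (rule cycle_necklace_orbit[OF assms], rule someI[of _ "g a"], rule orbit.base)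

text \<open>
  An injective equivariant map carries cycles to cycles of the same length. It therefore
  carries the lists of their elements to each other, whatever the starting point.
\<close>
lemma
  assumes "inj_on f A" and "g permutes A" and "\<And>x. x \<in> A \<Longrightarrow> f (g x) = h (f x)" and "a \<in> A"
  shows support_equivariant: "support h (f a) = map f (support g a)"
    and orbit_equivariant: "orbit h (f a) = f ` orbit g a"
proof -
  have A: "(g ^^ n) a \<in> A" for n
    using permutes_in_image[OF permutes_funpow[OF assms(2)]] assms(4) by metis
  have pow: "(h ^^ n) (f a) = f ((g ^^ n) a)" for n
    by (induction n) (simp_all add: assms(3)[OF A])
  have "(h ^^ n) (f a) = f a \<longleftrightarrow> (g ^^ n) a = a" for n
    unfolding pow using inj_on_eq_iff[OF assms(1) A assms(4)] .
  hence "least_power h (f a) = least_power g a" by (simp add: least_power_def)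
  thus "support h (f a) = map f (support g a)" by (simp add: pow)
  show "orbit h (f a) = f ` orbit g a" unfolding orbit_altdef pow by blast
qed

text \<open>
  The neck mess is an isomorphism invariant, because an isomorphism permutes the cycles together
  with their colors; the arbitrary starting point on each cycle does not matter, since another one
  gives the same necklace.
\<close>
lemma cycle_neck_mess_eq:
  assumes f: "f \<in> perm_isos A c g B d h" and A: "finite A"
    and g: "g permutes A" and h: "h permutes B"
  shows "cycle_neck_mess A c g = cycle_neck_mess B d h"
proof -
  have f: "bij_betw f A B" "\<And>x. x \<in> A \<Longrightarrow> d (f x) = c x" "\<And>x. x \<in> A \<Longrightarrow> f (g x) = h (f x)"
    using f by (simp_all add: perm_isos_def)
  have inj: "inj_on f A" and B: "B = f ` A" using f(1) by (auto simp: bij_betw_def)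
  have perm: "permutation g" "permutation h"
    using A g h B by (auto simp: permutation_permutes)
  have orb: "orbit h (f a) = f ` orbit g a" if "a \<in> A" for a
    using orbit_equivariant[OF inj g f(3) that] .
  have sub: "orbit g a \<subseteq> A" if "a \<in> A" for a using permutes_orbit_subset[OF g that] .
  have orbs: "orbit h ` B = (`) f ` (orbit g ` A)"
    unfolding B image_image using orb by simp
  have "inj_on ((`) f) (orbit g ` A)"
    by (rule inj_onI) (use sub inj in \<open>metis (no_types, lifting) imageE inj_on_image_eq_iff\<close>)
  hence "mset_set (orbit h ` B) = image_mset ((`) f) (mset_set (orbit g ` A))"
    unfolding orbs by (rule image_mset_mset_set[symmetric])
  hence "cycle_neck_mess B d h =
      image_mset (\<lambda>Z. cycle_necklace d h (SOME a. a \<in> f ` Z)) (mset_set (orbit g ` A))"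
    by (simp add: cycle_neck_mess_def image_mset.compositionality o_def)
  also have "\<dots> = cycle_neck_mess A c g"
    unfolding cycle_neck_mess_def
  proof (rule image_mset_cong)
    fix Z assume "Z \<in># mset_set (orbit g ` A)"
    then obtain a where a: "a \<in> A" "Z = orbit g a" using A by auto
    have supp: "set (support g a) \<subseteq> A"
      using permutes_in_image[OF permutes_funpow[OF g]] a(1) by auto
    have "map d (support h (f a)) = map c (support g a)"
      by (subst support_equivariant[OF inj g f(3) a(1)])
        (use supp f(2) in \<open>auto simp: image_subset_iff\<close>)
    moreover have "cycle_necklace d h (SOME b. b \<in> f ` Z) = cycle_necklace d h (f a)"
      using cycle_necklace_some[OF perm(2)] orb[OF a(1)] a(2) by metis
    moreover have "cycle_necklace c g (SOME a. a \<in> Z) = cycle_necklace c g a"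
      unfolding a(2) by (rule cycle_necklace_some[OF perm(1)])
    ultimately show "cycle_necklace d h (SOME a. a \<in> f ` Z) = cycle_necklace c g (SOME a. a \<in> Z)"
      by (simp only: cycle_necklace_def)
  qed
  finally show ?thesis by simp
qed

section \<open>The standard permutation with a given neck mess\<close>

text \<open>
  For a list of nonempty lists \<open>ps\<close>, the points \<open>(i, k)\<close> with \<open>k\<close> a position of
  \<open>ps ! i\<close>, moved by the cyclic shift of \<open>k\<close>, form a colored permutation whose cycles are
  the necklaces cut open to \<open>ps\<close>. Its automorphisms are what \<^const>\<open>neck_mess_auts\<close>
  describes, and every colored permutation with this neck mess is isomorphic to it.
\<close>

definition model_points :: "'c list list \<Rightarrow> (nat \<times> nat) set" where
  "model_points ps = (SIGMA i:{..<length ps}. {..<length (ps ! i)})"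

definition model_color :: "'c list list \<Rightarrow> nat \<times> nat \<Rightarrow> 'c" where
  "model_color ps = (\<lambda>(i, k). ps ! i ! k)"

definition model_shift :: "'c list list \<Rightarrow> nat \<times> nat \<Rightarrow> nat \<times> nat" where
  "model_shift ps = (\<lambda>(i, k). (i, Suc k mod length (ps ! i)))"

lemma model_shift_closed: "x \<in> model_points ps \<Longrightarrow> model_shift ps x \<in> model_points ps"
  by (auto simp: model_points_def model_shift_def intro!: mod_less_divisor intro: le_less_trans)

text \<open>
  Equality of the neck messes matches the cycles of \<open>g\<close> with the entries of \<open>ps\<close>. On
  each cycle a starting point \<open>st i\<close> can be chosen whose list of colors is \<open>ps ! i\<close> itself and
  not merely a rotation of it; then \<open>(i, k) \<mapsto> (g ^^ k) (st i)\<close> is an isomorphism.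
\<close>
lemma exists_model_iso:
  assumes A: "finite A" and g: "g permutes A"
    and mess: "cycle_neck_mess A c g = mset (map abs_necklace ps)"
    and ps: "\<And>p. p \<in> set ps \<Longrightarrow> p \<noteq> []"
  shows "perm_isos (model_points ps) (model_color ps) (model_shift ps) A c g \<noteq> {}"
proof -
  have perm: "permutation g" using A g by (auto simp: permutation_permutes)
  let ?F = "\<lambda>Z. cycle_necklace c g (SOME a. a \<in> Z)"
  obtain Ys where Ys: "distinct Ys" "set Ys = orbit g ` A"
    using finite_distinct_list[of "orbit g ` A"] A by auto
  have "mset (map ?F Ys) = mset (map abs_necklace ps)"
    using mess Ys by (simp add: cycle_neck_mess_def flip: mset_set_set)
  then obtain s where s: "s permutes {..<length (map ?F Ys)}"
    "permute_list s (map ?F Ys) = map abs_necklace ps"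
    by (metis mset_eq_permutation)
  define Zs where "Zs = permute_list s Ys"
  have Zs: "distinct Zs" "set Zs = orbit g ` A" "map ?F Zs = map abs_necklace ps"
    using s Ys by (auto simp: Zs_def permute_list_map)
  have len: "length Zs = length ps" using Zs(3) by (metis length_map)
  have start: "\<exists>a. a \<in> Zs ! i \<and> a \<in> A \<and> Zs ! i = orbit g a \<and> map c (support g a) = ps ! i"
    if i: "i < length ps" for i
  proof -
    obtain a where a: "a \<in> A" "Zs ! i = orbit g a"
      using i len Zs(2) by (metis imageE nth_mem)
    have "abs_necklace (map c (support g a)) = abs_necklace (ps ! i)"
      using cycle_necklace_some[OF perm, of c a] arg_cong[OF Zs(3), of "\<lambda>xs. xs ! i"] i len a(2)
      by (simp add: cycle_necklace_def)
    moreover have "map c (support g a) \<noteq> []" "ps ! i \<noteq> []"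
      using support_not_Nil[OF perm, of a] ps[OF nth_mem[OF i]] by simp_all
    ultimately obtain n where n: "ps ! i = rotate n (map c (support g a))"
      using abs_necklace_eq_iff by blast
    let ?b = "(g ^^ n) a"
    have b: "?b \<in> orbit g a" using orbit_altdef_permutation[OF perm] by blast
    have "map c (support g ?b) = ps ! i"
      unfolding n support_funpow[OF perm] by (simp add: rotate_map)
    moreover have "orbit g ?b = orbit g a"
      using b cyclic_on_orbit'[OF perm, of a] by (metis orbit_cyclic_eq3)
    moreover have "?b \<in> A" using permutes_orbit_subset[OF g a(1)] b by blast
    ultimately show ?thesis using a(2) b by metis
  qed
  define st where "st i = (SOME a. a \<in> Zs ! i \<and> a \<in> A \<and> Zs ! i = orbit g a \<and>
    map c (support g a) = ps ! i)" for i
  have st: "st i \<in> Zs ! i" "st i \<in> A" "Zs ! i = orbit g (st i)" "map c (support g (st i)) = ps ! i"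
    if "i < length ps" for i
    using someI_ex[OF start[OF that]] unfolding st_def by blast+
  have lp: "least_power g (st i) = length (ps ! i)" if "i < length ps" for i
    using arg_cong[OF st(4)[OF that], of length] by simp
  define f where "f = restrict (\<lambda>(i, k). (g ^^ k) (st i)) (model_points ps)"
  have f: "f (i, k) = (g ^^ k) (st i)" if "i < length ps" "k < length (ps ! i)" for i k
    using that by (simp add: f_def model_points_def)
  have orb: "f (i, k) \<in> Zs ! i" if "i < length ps" "k < length (ps ! i)" for i k
    unfolding f[OF that] st(3)[OF that(1)] using orbit_altdef_permutation[OF perm] by blast
  have inA: "f (i, k) \<in> A" if "i < length ps" "k < length (ps ! i)" for i k
    using orb[OF that] permutes_orbit_subset[OF g st(2)[OF that(1)]] st(3)[OF that(1)] by blast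
  \<comment> \<open>The list \<open>Zs\<close> has no repetitions, so different indices belong to disjoint cycles.\<close>
  have disj: "i = j" if "x \<in> Zs ! i" "x \<in> Zs ! j" "i < length ps" "j < length ps" for i j x
  proof -
    have "Zs ! i = Zs ! j"
      using that st(3) cyclic_on_orbit'[OF perm] orbit_cyclic_eq3 by metis
    thus ?thesis using Zs(1) that(3,4) len by (simp add: nth_eq_iff_index_eq)
  qed
  have "inj_on f (model_points ps)"
  proof (rule inj_onI)
    fix x y assume xy: "x \<in> model_points ps" "y \<in> model_points ps" "f x = f y"
    obtain i k j l where x: "x = (i, k)" and y: "y = (j, l)" by fastforce
    have *: "i < length ps" "j < length ps" "k < length (ps ! i)" "l < length (ps ! j)"
      using xy x y by (auto simp: model_points_def)
    have ij: "i = j" using disj orb * xy(3) x y by metis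
    have "support g (st i) ! k = support g (st i) ! l"
      using xy(3) x y ij * by (simp add: f lp)
    hence "k = l"
      using cycle_of_permutation[OF perm, of "st i"] * ij lp by (subst (asm) nth_eq_iff_index_eq) auto
    thus "x = y" using ij x y by simp
  qed
  moreover have "f ` model_points ps = A"
  proof
    show "f ` model_points ps \<subseteq> A" using inA by (auto simp: model_points_def)
    show "A \<subseteq> f ` model_points ps"
    proof
      fix a assume a: "a \<in> A"
      have aa: "a \<in> orbit g a" by (rule permutation_self_in_orbit[OF perm])
      obtain i where i: "i < length ps" "orbit g a = Zs ! i"
        using a Zs(2) len by (metis imageI in_set_conv_nth)
      have "a \<in> set (support g (st i))"
        using aa i st(3)[OF i(1)] support_set[OF perm, of "st i"] orbit_altdef_permutation[OF perm, of "st i"]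
        by auto
      then obtain k where "k < length (ps ! i)" "a = (g ^^ k) (st i)"
        using lp[OF i(1)] by auto
      thus "a \<in> f ` model_points ps"
        using i(1) f by (intro image_eqI[of _ _ "(i, k)"]) (auto simp: model_points_def)
    qed
  qed
  moreover have "c (f x) = model_color ps x" if x_in: "x \<in> model_points ps" for x
  proof -
    obtain i k where x: "x = (i, k)" "i < length ps" "k < length (ps ! i)"
      using x_in by (auto simp: model_points_def)
    have "ps ! i ! k = map c (support g (st i)) ! k" using st(4)[OF x(2)] by simp
    thus ?thesis using x lp[OF x(2)] by (simp add: f model_color_def)
  qed
  moreover have "f (model_shift ps x) = g (f x)" if x_in: "x \<in> model_points ps" for x
  proof -
    obtain i k where x: "x = (i, k)" "i < length ps" "k < length (ps ! i)"
      using x_in by (auto simp: model_points_def)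
    have "0 < length (ps ! i)" using x(3) by (rule gr_implies_not0[THEN neq0_conv[THEN iffD1]])
    hence "Suc k mod length (ps ! i) < length (ps ! i)" by (rule mod_less_divisor)
    hence "f (model_shift ps x) = (g ^^ (Suc k mod length (ps ! i))) (st i)"
      using x f[OF x(2)] by (simp add: model_shift_def)
    also have "\<dots> = (g ^^ Suc k) (st i)"
      using funpow_mod_eq[OF least_power_of_permutation(1)[OF perm, of "st i"]] lp[OF x(2)] by metis
    finally show ?thesis using x by (simp add: f)
  qed
  moreover have "f \<in> model_points ps \<rightarrow>\<^sub>E A"
    using inA by (auto simp: f_def model_points_def)
  ultimately have "f \<in> perm_isos (model_points ps) (model_color ps) (model_shift ps) A c g"
    by (simp add: perm_isos_def bij_betw_def)
  thus ?thesis by blast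
qed

text \<open>
  The first coordinate is constant along each cycle of the model. An automorphism therefore
  induces a permutation \<open>\<sigma>\<close> of the cycles, and maps the cycle \<open>i\<close> to the cycle \<open>\<sigma> i\<close> by an
  isomorphism of necklaces; these data can be prescribed freely.
\<close>
lemma card_model_auts:
  assumes ps: "\<And>p. p \<in> set ps \<Longrightarrow> p \<noteq> []"
  shows "card (perm_isos (model_points ps) (model_color ps) (model_shift ps)
             (model_points ps) (model_color ps) (model_shift ps)) =
         card (SIGMA \<sigma>:{\<sigma>. \<sigma> permutes {..<length ps}}.
           \<Pi>\<^sub>E i\<in>{..<length ps}. necklace_isos (ps ! i) (ps ! \<sigma> i))"
    (is "card ?I = card ?S")
proof -
  let ?P = "model_points ps" and ?n = "length ps"
  let ?l = "\<lambda>i. length (ps ! i)"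
  have P: "(i, k) \<in> ?P \<longleftrightarrow> i < ?n \<and> k < ?l i" for i k by (auto simp: model_points_def)
  have pos: "0 < ?l i" if "i < ?n" for i using ps[OF nth_mem[OF that]] by simp
  define \<Theta> where "\<Theta> = (\<lambda>(\<sigma>, f). restrict (\<lambda>(i, k). (\<sigma> i :: nat, f i k :: nat)) ?P)"
  have \<Theta>: "\<Theta> (\<sigma>, f) (i, k) = (\<sigma> i, f i k)" if "i < ?n" "k < ?l i" for \<sigma> f i k
    using that by (simp add: \<Theta>_def P)
  have nd: "f i k < ?l (\<sigma> i)" "bij_betw (f i) {..<?l i} {..<?l (\<sigma> i)}"
      "ps ! \<sigma> i ! f i k = ps ! i ! k" "f i (Suc k mod ?l i) = Suc (f i k) mod ?l (\<sigma> i)" "\<sigma> i < ?n"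
      if "(\<sigma>, f) \<in> ?S" "i < ?n" "k < ?l i" for \<sigma> f i k
  proof -
    have fi: "f i \<in> necklace_isos (ps ! i) (ps ! \<sigma> i)" "\<sigma> permutes {..<?n}" using that by auto
    show "bij_betw (f i) {..<?l i} {..<?l (\<sigma> i)}"
      "ps ! \<sigma> i ! f i k = ps ! i ! k" "f i (Suc k mod ?l i) = Suc (f i k) mod ?l (\<sigma> i)"
      using fi(1) that(3) by (simp_all add: necklace_isos_def)
    show "f i k < ?l (\<sigma> i)" using fi(1) that(3) by (auto simp: necklace_isos_def)
    show "\<sigma> i < ?n" using permutes_in_image[OF fi(2)] that(2) by simp
  qed
  have "bij_betw \<Theta> ?S ?I"
  proof (rule bij_betw_imageI)
    show "inj_on \<Theta> ?S"
    proof (rule inj_onI)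
      fix x y assume xy: "x \<in> ?S" "y \<in> ?S" "\<Theta> x = \<Theta> y"
      obtain \<sigma> f \<tau> h where x: "x = (\<sigma>, f)" and y: "y = (\<tau>, h)" by fastforce
      have eq: "\<sigma> i = \<tau> i" "f i k = h i k" if "i < ?n" "k < ?l i" for i k
        using fun_cong[OF xy(3), of "(i, k)"] \<Theta>[OF that] x y by auto
      have "\<sigma> = \<tau>"
      proof
        fix i
        show "\<sigma> i = \<tau> i"
        proof (cases "i < ?n")
          case True thus ?thesis using eq pos by blast
        next
          case False
          have "\<sigma> permutes {..<?n}" "\<tau> permutes {..<?n}" using xy x y by auto
          thus ?thesis using False by (metis lessThan_iff permutes_not_in)
        qed
      qed
      moreover have "f = h"
      proof
        fix i
        show "f i = h i"
        proof (cases "i < ?n")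
          case True
          have "f i \<in> extensional {..<?l i}" "h i \<in> extensional {..<?l i}"
            using xy x y True by (auto simp: necklace_isos_def PiE_iff)
          thus ?thesis using eq(2)[OF True] by (auto intro: extensionalityI)
        next
          case False
          have "f \<in> extensional {..<?n}" "h \<in> extensional {..<?n}"
            using xy x y by (auto simp: PiE_iff)
          thus ?thesis using False by (simp add: extensional_def)
        qed
      qed
      ultimately show "x = y" using x y by simp
    qed
    show "\<Theta> ` ?S = ?I"
    proof (intro equalityI subsetI)
      fix F assume "F \<in> \<Theta> ` ?S"
      then obtain \<sigma> f where S: "(\<sigma>, f) \<in> ?S" and F: "F = \<Theta> (\<sigma>, f)" by auto
      have \<sigma>: "\<sigma> permutes {..<?n}" using S by auto
      have "inj_on F ?P"
      proof (rule inj_onI)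
        fix x y assume xy: "x \<in> ?P" "y \<in> ?P" "F x = F y"
        obtain i k j l where x: "x = (i, k)" and y: "y = (j, l)" by fastforce
        have *: "i < ?n" "k < ?l i" "j < ?n" "l < ?l j" using xy x y P by auto
        hence "\<sigma> i = \<sigma> j" "f i k = f j l" using xy(3) x y by (simp_all add: F \<Theta>)
        moreover from this have "i = j" using permutes_inj[OF \<sigma>] by (simp add: inj_eq)
        moreover have "k = l"
          using nd(2)[OF S *(1,2)] * calculation by (auto simp: bij_betw_def inj_on_def)
        ultimately show "x = y" using x y by simp
      qed
      moreover have FP: "F ` ?P \<subseteq> ?P"
        using nd[OF S] by (auto simp: F \<Theta> P model_points_def)
      moreover have "finite ?P" by (simp add: model_points_def)
      ultimately have "bij_betw F ?P ?P"
        by (metis bij_betw_imageI endo_inj_surj)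
      moreover have "F \<in> ?P \<rightarrow>\<^sub>E ?P" using FP by (auto simp: F \<Theta>_def)
      moreover have "model_color ps (F x) = model_color ps x" if "x \<in> ?P" for x
        using that nd[OF S] by (cases x) (auto simp: F \<Theta> P model_color_def)
      moreover have "F (model_shift ps x) = model_shift ps (F x)" if x_in: "x \<in> ?P" for x
      proof -
        obtain i k where x: "x = (i, k)" "i < ?n" "k < ?l i"
          using x_in by (auto simp: model_points_def)
        have "Suc k mod ?l i < ?l i" using pos[OF x(2)] by simp
        thus ?thesis using x nd[OF S x(2,3)] by (simp add: F \<Theta> model_shift_def)
      qed
      ultimately show "F \<in> ?I" by (simp add: perm_isos_def)
    next
      fix F assume I: "F \<in> ?I"
      have F: "F \<in> ?P \<rightarrow>\<^sub>E ?P" "bij_betw F ?P ?P"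
        "\<And>x. x \<in> ?P \<Longrightarrow> model_color ps (F x) = model_color ps x"
        "\<And>x. x \<in> ?P \<Longrightarrow> F (model_shift ps x) = model_shift ps (F x)"
        using I by (simp_all add: perm_isos_def)
      define \<sigma> where "\<sigma> i = (if i < ?n then fst (F (i, 0)) else i)" for i
      define f where "f = (\<lambda>i\<in>{..<?n}. \<lambda>k\<in>{..<?l i}. snd (F (i, k)))"
      have fstF: "fst (F (i, k)) = \<sigma> i" if "i < ?n" "k < ?l i" for i k
        using that(2)
      proof (induction k)
        case (Suc k)
        have "F (i, Suc k) = model_shift ps (F (i, k))"
          using F(4)[of "(i, k)"] Suc that(1) P by (simp add: model_shift_def)
        thus ?case using Suc by (simp add: model_shift_def case_prod_unfold)
      qed (simp add: \<sigma>_def that(1))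
      have FE: "F (i, k) = (\<sigma> i, f i k)" if "i < ?n" "k < ?l i" for i k
        using fstF[OF that] that by (simp add: f_def prod_eq_iff)
      have FP: "\<sigma> i < ?n" "f i k < ?l (\<sigma> i)" if "i < ?n" "k < ?l i" for i k
        using PiE_mem[OF F(1), of "(i, k)"] that P FE by auto
      have "\<sigma> ` {..<?n} = {..<?n}"
      proof (intro equalityI subsetI)
        fix j assume "j \<in> {..<?n}"
        hence "(j, 0) \<in> F ` ?P" using F(2) pos P by (auto simp: bij_betw_def)
        then obtain i k where "i < ?n" "k < ?l i" "F (i, k) = (j, 0)" using P by force
        thus "j \<in> \<sigma> ` {..<?n}" using FE by force
      qed (use FP(1)[OF _ pos] in auto)
      hence "bij_betw \<sigma> {..<?n} {..<?n}"
        by (simp add: bij_betw_def finite_surj_inj)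
      hence \<sigma>: "\<sigma> permutes {..<?n}"
        by (rule bij_imp_permutes) (simp add: \<sigma>_def)
      have "f i \<in> necklace_isos (ps ! i) (ps ! \<sigma> i)" if i: "i < ?n" for i
      proof -
        have "inj_on (f i) {..<?l i}"
        proof (rule inj_onI)
          fix k l assume kl: "k \<in> {..<?l i}" "l \<in> {..<?l i}" "f i k = f i l"
          hence "F (i, k) = F (i, l)" using FE i by simp
          thus "k = l" using F(2) kl i P by (auto simp: bij_betw_def dest: inj_onD)
        qed
        moreover have "f i ` {..<?l i} = {..<?l (\<sigma> i)}"
        proof (intro equalityI subsetI)
          fix l assume "l \<in> {..<?l (\<sigma> i)}"
          hence "(\<sigma> i, l) \<in> F ` ?P" using F(2) FP[OF i] pos[OF i] P by (auto simp: bij_betw_def)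
          then obtain j k where j: "j < ?n" "k < ?l j" "F (j, k) = (\<sigma> i, l)" using P by force
          hence "\<sigma> j = \<sigma> i" "f j k = l" using FE by auto
          thus "l \<in> f i ` {..<?l i}" using permutes_inj[OF \<sigma>] j(2) by (auto simp: inj_eq)
        qed (use FP[OF i] in auto)
        moreover have "ps ! \<sigma> i ! f i k = ps ! i ! k" if "k < ?l i" for k
          using F(3)[of "(i, k)"] i that P FE by (simp add: model_color_def)
        moreover have "f i (Suc k mod ?l i) = Suc (f i k) mod ?l (\<sigma> i)" if "k < ?l i" for k
        proof -
          have "Suc k mod ?l i < ?l i" using pos[OF i] by simp
          thus ?thesis using F(4)[of "(i, k)"] i that P FE by (simp add: model_shift_def)
        qed
        moreover have "f i \<in> {..<?l i} \<rightarrow>\<^sub>E {..<?l (\<sigma> i)}"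
          using FP[OF i] i by (auto simp: f_def)
        ultimately show ?thesis by (simp add: necklace_isos_def bij_betw_def)
      qed
      hence "(\<sigma>, f) \<in> ?S" using \<sigma> by (auto simp: f_def)
      moreover have "\<Theta> (\<sigma>, f) = F"
      proof
        fix x
        show "\<Theta> (\<sigma>, f) x = F x"
        proof (cases "x \<in> ?P")
          case True thus ?thesis using FE \<Theta> P by (cases x) auto
        next
          case False thus ?thesis by (simp add: \<Theta>_def PiE_arb[OF F(1)])
        qed
      qed
      ultimately show "F \<in> \<Theta> ` ?S" by (rule rev_image_eqI[OF _ sym])
    qed
  qed
  thus ?thesis by (rule bij_betw_same_card[symmetric])
qed

text \<open>
  A neck mess determines its colored permutations up to isomorphism, and its automorphisms count
  their isomorphisms. This is the source of the factor \<open>#Aut(\<nu>)\<close> in the structure constants.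
\<close>
lemma
  fixes c :: "'a \<Rightarrow> nat" and d :: "'b \<Rightarrow> nat"
  assumes A: "finite A" "g permutes A" "cycle_neck_mess A c g = \<theta>"
    and B: "finite B" "h permutes B" "cycle_neck_mess B d h = \<theta>"
  shows card_perm_isos: "card (perm_isos A c g B d h) = card (neck_mess_auts \<theta>)"
    and perm_isos_nonempty: "perm_isos A c g B d h \<noteq> {}"
proof -
  define qs where "qs = (SOME qs. mset qs = \<theta>)"
  have qs: "mset qs = \<theta>" unfolding qs_def by (rule someI_ex, rule ex_mset)
  define ps where "ps = map rep_necklace qs"
  have "map abs_necklace ps = qs"
    by (simp add: ps_def o_def Quotient3_abs_rep[OF Quotient3_necklace])
  hence \<theta>: "mset (map abs_necklace ps) = \<theta>" using qs by simp
  have ps: "p \<noteq> []" if "p \<in> set ps" for p using that by (auto simp: ps_def rep_necklace_not_Nil)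
  let ?M = "perm_isos (model_points ps) (model_color ps) (model_shift ps)"
  have auts: "card (neck_mess_auts \<theta>) = card (?M (model_points ps) (model_color ps) (model_shift ps))"
    using card_model_auts[of ps] ps
    by (simp add: neck_mess_auts_def Let_def flip: qs_def ps_def)
  obtain a where a: "a \<in> ?M A c g" using exists_model_iso[OF A(1,2), of c ps] A(3) \<theta> ps by auto
  obtain b where b: "b \<in> ?M B d h" using exists_model_iso[OF B(1,2), of d ps] B(3) \<theta> ps by auto
  have gA: "\<And>x. x \<in> A \<Longrightarrow> g x \<in> A" using A(2) by (simp add: permutes_in_image)
  show "card (perm_isos A c g B d h) = card (neck_mess_auts \<theta>)"
    using card_perm_isos_source[OF a model_shift_closed]
      card_perm_isos_target[OF b model_shift_closed model_shift_closed] auts by (rule trans[OF _ trans[OF sym sym]])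
  show "perm_isos A c g B d h \<noteq> {}"
    using perm_isos_compose[OF perm_isos_inverse[OF a model_shift_closed] b gA] by blast
qed

section \<open>Reading every second element of a cycle\<close>

lemma filter_rotate: "\<exists>m. filter P (rotate n xs) = rotate m (filter P xs)"
proof (induction n)
  case 0 show ?case by (rule exI[of _ 0]) simp
next
  case (Suc n)
  have "\<exists>k. filter P (rotate1 ys) = rotate k (filter P ys)" for ys
  proof (cases ys)
    case (Cons y zs)
    show ?thesis by (rule exI[of _ "if P y then 1 else 0"]) (simp add: Cons)
  qed simp
  then obtain k where "filter P (rotate1 (rotate n xs)) = rotate k (filter P (rotate n xs))" by blast
  thus ?case using Suc by (auto simp: rotate_rotate)
qed

text \<open>
  Around a vertex of a surface, the darts that contribute a bead alternate with darts that do
  not. In this locale \<open>r\<close> is the rotation around the vertices, \<open>u e\<close> is the contributing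
  dart of the chamber \<open>e\<close>, and two steps of \<open>r\<close> lead from the chamber \<open>e\<close> to the
  chamber \<open>g e\<close>. So a cycle of \<open>r\<close>, read at every second place, is a cycle of \<open>g\<close>.
\<close>
locale alternating =
  fixes r :: "'d \<Rightarrow> 'd" and u :: "'e \<Rightarrow> 'd" and P :: "'d \<Rightarrow> bool" and A :: "'e set" and g :: "'e \<Rightarrow> 'e"
  assumes r: "permutation r" and A: "finite A" and g: "g permutes A" and u: "inj_on u A"
    and step: "\<And>e. e \<in> A \<Longrightarrow> r (r (u e)) = u (g e)"
    and P: "\<And>e. e \<in> A \<Longrightarrow> P (u e)" "\<And>e. e \<in> A \<Longrightarrow> \<not> P (r (u e))"
begin

lemma perm_g: "permutation g" using A g by (auto simp: permutation_permutes)

lemma funpow_closed: "e \<in> A \<Longrightarrow> (g ^^ n) e \<in> A"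
  using permutes_in_image[OF permutes_funpow[OF g]] by metis

lemma funpow_even: "e \<in> A \<Longrightarrow> (r ^^ (2 * n)) (u e) = u ((g ^^ n) e)"
  by (induction n) (simp_all add: step funpow_closed)

lemma funpow_odd: "e \<in> A \<Longrightarrow> (r ^^ Suc (2 * n)) (u e) = r (u ((g ^^ n) e))"
  using funpow_even[of e n] by simp

lemma orbit_alternating:
  assumes e: "e \<in> A"
  shows "orbit r (u e) = u ` orbit g e \<union> (\<lambda>x. r (u x)) ` orbit g e"
proof -
  have "(\<exists>n. y = (r ^^ n) (u e)) \<longleftrightarrow>
      (\<exists>n. y = u ((g ^^ n) e)) \<or> (\<exists>n. y = r (u ((g ^^ n) e)))" for y
  proof
    assume "\<exists>n. y = (r ^^ n) (u e)"
    then obtain n where "y = (r ^^ n) (u e)" ..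
    thus "(\<exists>n. y = u ((g ^^ n) e)) \<or> (\<exists>n. y = r (u ((g ^^ n) e)))"
      using funpow_even[OF e, of "n div 2"] funpow_odd[OF e, of "n div 2"]
      by (cases "even n") (auto simp: odd_two_times_div_two_succ)
  next
    assume "(\<exists>n. y = u ((g ^^ n) e)) \<or> (\<exists>n. y = r (u ((g ^^ n) e)))"
    thus "\<exists>n. y = (r ^^ n) (u e)" using funpow_even[OF e] funpow_odd[OF e] by metis
  qed
  thus ?thesis
    unfolding orbit_altdef_permutation[OF r] orbit_altdef_permutation[OF perm_g] by auto
qed

text \<open>An odd power of \<open>r\<close> cannot fix \<open>u e\<close>, because \<open>P\<close> changes at every step.\<close>
lemma least_power_alternating:
  assumes e: "e \<in> A"
  shows "least_power r (u e) = 2 * least_power g e"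
proof (rule dvd_antisym)
  have "(r ^^ (2 * least_power g e)) (u e) = u e"
    using funpow_even[OF e] least_power_of_permutation(1)[OF perm_g] by metis
  thus "least_power r (u e) dvd 2 * least_power g e" by (rule least_power_minimal)
  let ?l = "least_power r (u e)"
  have l: "(r ^^ ?l) (u e) = u e" by (rule least_power_of_permutation(1)[OF r])
  have even: "even ?l"
  proof (rule ccontr)
    assume "odd ?l"
    hence "r (u ((g ^^ (?l div 2)) e)) = u e"
      using l funpow_odd[OF e, of "?l div 2"] by (simp add: odd_two_times_div_two_succ)
    thus False using P(2)[OF funpow_closed[OF e], of "?l div 2"] P(1)[OF e] by simp
  qed
  hence "u ((g ^^ (?l div 2)) e) = u e" using l funpow_even[OF e, of "?l div 2"] by simp
  hence "(g ^^ (?l div 2)) e = e" using u e funpow_closed[OF e] by (meson inj_onD)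
  hence "least_power g e dvd ?l div 2" by (rule least_power_minimal)
  hence "2 * least_power g e dvd 2 * (?l div 2)" by (rule mult_dvd_mono[OF dvd_refl])
  thus "2 * least_power g e dvd ?l" using even by simp
qed

lemma filter_support:
  assumes e: "e \<in> A"
  shows "filter P (support r (u e)) = map u (support g e)"
proof -
  have "filter P (map (\<lambda>i. (r ^^ i) (u e)) [0..<2 * n]) = map (\<lambda>i. u ((g ^^ i) e)) [0..<n]" for n
  proof (induction n)
    case (Suc n)
    have "[0..<2 * Suc n] = [0..<2 * n] @ [2 * n, Suc (2 * n)]"
      by simp
    thus ?case
      using Suc funpow_even[OF e, of n] funpow_odd[OF e, of n] P[OF funpow_closed[OF e], of n] by simp
  qed simp
  thus ?thesis by (simp add: least_power_alternating[OF e] o_def)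
qed

text \<open>
  The cycle of \<open>r\<close> belonging to a cycle \<open>Z\<close> of \<open>g\<close> is \<open>\<rho> Z\<close>, and \<open>Z\<close> is recovered
  from it as the set of contributing points. The starting point chosen on \<open>\<rho> Z\<close> may fail
  \<open>P\<close>, but filtering a rotated list still gives a rotation of the filtered list.
\<close>
lemma cycle_neck_mess_alternating:
  assumes col: "\<And>e. e \<in> A \<Longrightarrow> col (u e) = c e"
  shows "image_mset (\<lambda>V. abs_necklace (map col (filter P (support r (SOME d. d \<in> V)))))
           (mset_set ((\<lambda>e. orbit r (u e)) ` A)) = cycle_neck_mess A c g"
proof -
  define \<rho> where "\<rho> Z = u ` Z \<union> (\<lambda>x. r (u x)) ` Z" for Z
  have sub: "orbit g e \<subseteq> A" if "e \<in> A" for e using permutes_orbit_subset[OF g that] .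
  have orb: "orbit r (u e) = \<rho> (orbit g e)" if "e \<in> A" for e
    unfolding \<rho>_def by (rule orbit_alternating[OF that])
  have img: "(\<lambda>e. orbit r (u e)) ` A = \<rho> ` (orbit g ` A)"
    unfolding image_image using orb by simp
  have "inj_on \<rho> (orbit g ` A)"
  proof (rule inj_onI)
    have *: "Z = {e \<in> A. u e \<in> \<rho> Z}" if "Z \<in> orbit g ` A" for Z
    proof -
      have Z: "Z \<subseteq> A" using that sub by auto
      have "e \<in> Z" if e: "e \<in> A" "u e \<in> \<rho> Z" for e
      proof -
        from e(2) consider z where "z \<in> Z" "u e = u z" | z where "z \<in> Z" "u e = r (u z)"
          by (auto simp: \<rho>_def)
        thus ?thesis
        proof cases
          case 1
          thus ?thesis using inj_onD[OF u, of e z] e(1) Z by auto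
        next
          case 2
          thus ?thesis using P(1)[OF e(1)] P(2)[of z] Z by auto
        qed
      qed
      thus ?thesis using Z by (auto simp: \<rho>_def)
    qed
    fix X Y assume "X \<in> orbit g ` A" "Y \<in> orbit g ` A" "\<rho> X = \<rho> Y"
    thus "X = Y" using *[of X] *[of Y] by simp
  qed
  hence "mset_set ((\<lambda>e. orbit r (u e)) ` A) = image_mset \<rho> (mset_set (orbit g ` A))"
    unfolding img by (rule image_mset_mset_set[symmetric])
  hence "image_mset (\<lambda>V. abs_necklace (map col (filter P (support r (SOME d. d \<in> V)))))
      (mset_set ((\<lambda>e. orbit r (u e)) ` A)) =
      image_mset (\<lambda>Z. abs_necklace (map col (filter P (support r (SOME d. d \<in> \<rho> Z)))))
      (mset_set (orbit g ` A))"
    by (simp add: image_mset.compositionality o_def)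
  also have "\<dots> = cycle_neck_mess A c g"
    unfolding cycle_neck_mess_def
  proof (rule image_mset_cong)
    fix Z assume "Z \<in># mset_set (orbit g ` A)"
    then obtain e where e: "e \<in> A" "Z = orbit g e" using A by auto
    let ?d = "SOME d. d \<in> \<rho> Z"
    have "?d \<in> orbit r (u e)"
      using orb[OF e(1)] e(2) orbit.base[of r "u e"] by (metis someI_ex)
    then obtain n where "?d = (r ^^ n) (u e)" by (auto simp: orbit_altdef)
    hence "support r ?d = rotate n (support r (u e))" using support_funpow[OF r] by metis
    then obtain m where m: "filter P (support r ?d) = rotate m (map u (support g e))"
      using filter_rotate filter_support[OF e(1)] by metis
    have "set (support g e) \<subseteq> A" using funpow_closed[OF e(1)] by auto
    hence "map col (map u (support g e)) = map c (support g e)"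
      using col by auto
    hence "map col (filter P (support r ?d)) = rotate m (map c (support g e))"
      unfolding m by (simp add: rotate_map)
    hence "abs_necklace (map col (filter P (support r ?d))) = abs_necklace (map c (support g e))"
      using support_not_Nil[OF perm_g, of e] abs_necklace_eq_iff
      by (metis map_is_Nil_conv rotate_is_Nil_conv)
    also have "\<dots> = cycle_necklace c g (SOME a. a \<in> Z)"
      unfolding e(2) cycle_necklace_some[OF perm_g] by (simp add: cycle_necklace_def)
    finally show "abs_necklace (map col (filter P (support r ?d))) =
      cycle_necklace c g (SOME a. a \<in> Z)" .
  qed
  finally show ?thesis .
qed

end

section \<open>Surfaces with labelled chambers\<close>

text \<open>
  A chamber consists of a plus-triangle and a minus-triangle, with one side of each color. So, once
  the chambers are labelled by a set \<open>E\<close>, the darts are the triples \<open>(e, b, x)\<close>: the side of color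
  \<open>x\<close> of the plus-triangle (\<open>b = True\<close>) or minus-triangle (\<open>b = False\<close>) of the chamber \<open>e\<close>.
  The function \<open>side_next\<close> goes counterclockwise along the boundary of a triangle, where the
  colors come in their natural order for plus-triangles only.
\<close>

fun side_next :: "'e \<times> bool \<times> edge_color \<Rightarrow> 'e \<times> bool \<times> edge_color" where
  "side_next (e, b, x) = (e, b, if b then next_color x else next_color (next_color x))"

text \<open>
  The gluing of the chambers. Inside a chamber the two triangles share their \<open>FarUV\<close> edge. The
  \<open>NearIR\<close> side of the plus-triangle of \<open>e\<close> is glued to the minus-triangle of \<open>q e\<close>, and
  the \<open>MidIR\<close> side of the minus-triangle of \<open>e\<close> to the plus-triangle of \<open>p e\<close>. The
  choice of \<open>p\<close> rather than its inverse makes the rotations around the three types of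
  vertices act on the labels as \<open>q\<close>, \<open>p\<close> and \<open>p \<circ> q\<close>.
\<close>
fun side_flip ::
  "('e \<Rightarrow> 'e) \<Rightarrow> ('e \<Rightarrow> 'e) \<Rightarrow> 'e \<times> bool \<times> edge_color \<Rightarrow> 'e \<times> bool \<times> edge_color"
where
  "side_flip p q (e, b, FarUV) = (e, \<not> b, FarUV)"
| "side_flip p q (e, True, NearIR) = (q e, False, NearIR)"
| "side_flip p q (e, False, NearIR) = (inv q e, True, NearIR)"
| "side_flip p q (e, True, MidIR) = (inv p e, False, MidIR)"
| "side_flip p q (e, False, MidIR) = (p e, True, MidIR)"

lemma next_color_cycle: "next_color (next_color (next_color x)) = x"
  by (cases x) simp_all

lemma next_color_neq: "next_color x \<noteq> x" "next_color (next_color x) \<noteq> x"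
    "x \<noteq> next_color x" "x \<noteq> next_color (next_color x)"
  by (cases x; simp)+

lemma UNIV_edge_color: "UNIV = {x, next_color x, next_color (next_color x)}"
proof -
  have "y \<in> {x, next_color x, next_color (next_color x)}" for y
    by (cases x; cases y) simp_all
  thus ?thesis by blast
qed

lemma side_next_cycle: "side_next (side_next (side_next y)) = y"
  by (cases y) (auto simp: next_color_cycle)

lemma side_next_in: "side_next y \<in> E \<times> UNIV \<longleftrightarrow> y \<in> E \<times> UNIV"
  by (cases y) auto

lemma side_flip_in:
  assumes "p permutes E" "q permutes E" "y \<in> E \<times> UNIV"
  shows "side_flip p q y \<in> E \<times> UNIV"
  using assms permutes_in_image[OF assms(1)] permutes_in_image[OF assms(2)]
    permutes_in_image[OF permutes_inv[OF assms(1)]] permutes_in_image[OF permutes_inv[OF assms(2)]]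
  by (cases "(p, q, y)" rule: side_flip.cases) auto

lemma side_flip_flip:
  assumes "p permutes E" "q permutes E"
  shows "side_flip p q (side_flip p q y) = y"
  by (cases "(p, q, y)" rule: side_flip.cases)
    (auto simp: permutes_inverses[OF assms(1)] permutes_inverses[OF assms(2)])

lemma side_flip_neq: "side_flip p q y \<noteq> y"
  by (cases "(p, q, y)" rule: side_flip.cases) auto

lemma side_flip_color: "snd (snd (side_flip p q y)) = snd (snd y)"
  and side_flip_sign: "fst (snd (side_flip p q y)) \<longleftrightarrow> \<not> fst (snd y)"
  by (cases "(p, q, y)" rule: side_flip.cases; simp)+

lemma orbit_side_next: "orbit side_next (e, b, x) = {e} \<times> {b} \<times> UNIV"
proof -
  have "orbit side_next (e, b, x) = {(side_next ^^ m) (e, b, x) | m. m < 3}"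
    by (rule orbit_altdef_bounded) (simp_all add: eval_nat_numeral next_color_cycle)
  also have "\<dots> = {(e, b, x), side_next (e, b, x), side_next (side_next (e, b, x))}"
  proof -
    have "{f m | m. m < (3::nat)} = {f 0, f 1, f 2}" for f :: "nat \<Rightarrow> 'a \<times> bool \<times> edge_color"
      by (auto simp: less_Suc_eq numeral_3_eq_3 numeral_2_eq_2)
    thus ?thesis by (simp only:) (simp add: numeral_2_eq_2)
  qed
  also have "\<dots> = {(e, b, x), (e, b, next_color x), (e, b, next_color (next_color x))}"
    by (auto simp: next_color_cycle)
  also have "\<dots> = {e} \<times> {b} \<times> UNIV"
    unfolding UNIV_edge_color[of x] by auto
  finally show ?thesis .
qed

text \<open>
  The surface \<open>H\<close> with its chambers labelled by \<open>E\<close>, where the label \<open>e\<close> has the color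
  \<open>c e\<close>, is glued according to \<open>p\<close> and \<open>q\<close>. The labels may have any type: besides the chambers
  of \<open>H\<close> these can be the elements of \<open>\<Omega>\<close>, and relabelling \<open>H\<close> by \<open>\<Omega>\<close> is the
  basis of the final count.
\<close>
locale surface_chart =
  fixes H :: "'d surface" and E :: "'e set" and p q :: "'e \<Rightarrow> 'e" and c :: "'e \<Rightarrow> nat"
    and D :: "'e \<times> bool \<times> edge_color \<Rightarrow> 'd"
  assumes E: "finite E" and p: "p permutes E" and q: "q permutes E"
    and rot: "rot H permutes darts H" and flip: "flip H permutes darts H"
    and D: "bij_betw D (E \<times> UNIV) (darts H)"
    and face_next_D: "y \<in> E \<times> UNIV \<Longrightarrow> face_next H (D y) = D (side_next y)"
    and flip_D: "y \<in> E \<times> UNIV \<Longrightarrow> flip H (D y) = D (side_flip p q y)"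
    and edge_color_D: "y \<in> E \<times> UNIV \<Longrightarrow> edge_color H (D y) = snd (snd y)"
    and chamber_color_D: "e \<in> E \<Longrightarrow> chamber_color H (D ` ({e} \<times> UNIV)) = c e"
begin

lemma D_eq_iff: "y \<in> E \<times> UNIV \<Longrightarrow> z \<in> E \<times> UNIV \<Longrightarrow> D y = D z \<longleftrightarrow> y = z"
  using inj_on_eq_iff[OF bij_betw_imp_inj_on[OF D]] .

lemma D_in: "y \<in> E \<times> UNIV \<Longrightarrow> D y \<in> darts H"
  using D by (auto simp: bij_betw_def)

lemma dart_cases:
  assumes "d \<in> darts H"
  obtains e b x where "e \<in> E" "d = D (e, b, x)"
proof -
  have "d \<in> D ` (E \<times> UNIV)" using assms D by (simp add: bij_betw_def)
  thus thesis using that by fastforce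
qed

lemma side_flip_in_E: "y \<in> E \<times> UNIV \<Longrightarrow> side_flip p q y \<in> E \<times> UNIV"
  by (rule side_flip_in[OF p q])

lemma finite_darts: "finite (darts H)"
proof -
  have "finite (UNIV :: edge_color set)" by (simp add: UNIV_edge_color[of FarUV])
  hence "finite (E \<times> (UNIV :: (bool \<times> edge_color) set))"
    using E by (simp add: finite_prod)
  thus ?thesis using bij_betw_finite[OF D] by simp
qed

lemma permutation_rot: "permutation (rot H)" "permutation (inv (rot H))"
  using finite_darts rot permutes_inv[OF rot] by (auto simp: permutation_permutes)

lemma rot_D:
  assumes y: "y \<in> E \<times> UNIV"
  shows "rot H (D y) = D (side_flip p q (side_next (side_next y)))"
proof -
  have y2: "side_next (side_next y) \<in> E \<times> UNIV" using y by (simp only: side_next_in)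
  have "D y = inv (rot H) (flip H (D (side_next (side_next y))))"
    using face_next_D[OF y2] by (simp add: face_next_def side_next_cycle)
  thus ?thesis
    using flip_D[OF y2] permutes_inverses(1)[OF rot] by simp
qed

lemma inv_rot_D:
  assumes y: "y \<in> E \<times> UNIV"
  shows "inv (rot H) (D y) = D (side_next (side_flip p q y))"
  using face_next_D[OF side_flip_in_E[OF y]] flip_D[OF side_flip_in_E[OF y]]
  by (simp add: face_next_def side_flip_flip[OF p q])

lemma face_D:
  assumes e: "e \<in> E"
  shows "face H (D (e, b, x)) = D ` ({e} \<times> {b} \<times> UNIV)"
proof -
  have "D ` orbit side_next (e, b, x) = orbit (face_next H) (D (e, b, x))"
  proof (rule orbit_inverse)
    show "(e, b, x) \<in> orbit side_next (e, b, x)" by (simp add: orbit_side_next)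
    fix y assume "y \<in> orbit side_next (e, b, x)"
    thus "face_next H (D y) = D (side_next y)"
      using e by (intro face_next_D) (auto simp: orbit_side_next)
  qed
  thus ?thesis by (simp add: face_def orbit_side_next)
qed

lemma
  assumes e: "e \<in> E"
  shows plus_triangle_D: "plus_triangle H (face H (D (e, b, x))) \<longleftrightarrow> b"
    and minus_triangle_D: "minus_triangle H (face H (D (e, b, x))) \<longleftrightarrow> \<not> b"
proof -
  let ?T = "{e} \<times> {b} \<times> (UNIV :: edge_color set)"
  have T: "?T \<subseteq> E \<times> UNIV" using e by auto
  have "card (UNIV :: edge_color set) = 3" by (simp add: UNIV_edge_color[of FarUV])
  hence "card ?T = 3" by (simp add: card_cartesian_product)
  moreover have "inj_on D ?T" using D T by (auto simp: bij_betw_def intro: inj_on_subset)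
  ultimately have card: "card (D ` ?T) = 3" by (simp add: card_image)
  have col: "edge_color H (D (e, b, z)) = z" for z using edge_color_D[of "(e, b, z)"] e by simp
  have colors: "edge_color H ` D ` ?T = UNIV"
    using col by (auto simp: image_iff)
  have nxt: "edge_color H (face_next H (D (e, b, z))) =
      (if b then next_color z else next_color (next_color z))" for z
    using face_next_D[of "(e, b, z)"] col e by simp
  show "plus_triangle H (face H (D (e, b, x))) \<longleftrightarrow> b"
    unfolding plus_triangle_def face_D[OF e]
    using card colors nxt col next_color_neq by (auto simp: image_iff)
  show "minus_triangle H (face H (D (e, b, x))) \<longleftrightarrow> \<not> b"
    unfolding minus_triangle_def face_D[OF e]
    using card colors nxt col next_color_neq by (auto simp: image_iff next_color_cycle)
qed

lemma checker_surface: "checker_surface H"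
proof -
  have "flip H d \<noteq> d \<and> flip H (flip H d) = d \<and> edge_color H (flip H d) = edge_color H d \<and>
      (plus_triangle H (face H d) \<longleftrightarrow> minus_triangle H (face H (flip H d)))"
    if d: "d \<in> darts H" for d
  proof -
    obtain e b x where e: "e \<in> E" "d = D (e, b, x)" by (rule dart_cases[OF d])
    let ?y = "(e, b, x)"
    have y: "?y \<in> E \<times> UNIV" "side_flip p q ?y \<in> E \<times> UNIV"
      using e side_flip_in_E[of ?y] by auto
    obtain e' b' x' where f: "side_flip p q ?y = (e', b', x')" using prod_cases3 by blast
    have f': "e' \<in> E" "b' = (\<not> b)" "x' = x"
      using y f side_flip_sign[of p q ?y] side_flip_color[of p q ?y] by auto
    show ?thesis
      using y flip_D[OF y(1)] flip_D[OF y(2)] side_flip_flip[OF p q, of ?y] side_flip_neq[of p q ?y]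
        edge_color_D[OF y(1)] edge_color_D[OF y(2)] D_eq_iff[OF y(2) y(1)]
        plus_triangle_D[OF e(1)] minus_triangle_D[OF f'(1)] f f' e(2) by simp
  qed
  moreover have "plus_triangle H T \<or> minus_triangle H T" if "T \<in> faces H" for T
    using that plus_triangle_D minus_triangle_D dart_cases unfolding faces_def
    by (metis imageE)
  ultimately show ?thesis
    unfolding checker_surface_def using finite_darts rot flip by blast
qed

lemma card_faces: "card (faces H) = 2 * card E"
proof -
  have "faces H = (\<lambda>(e, b). D ` ({e} \<times> {b} \<times> UNIV)) ` (E \<times> UNIV)"
  proof (intro equalityI subsetI)
    fix T assume "T \<in> faces H"
    then obtain d where d: "d \<in> darts H" "T = face H d" by (auto simp: faces_def)
    obtain e b x where "e \<in> E" "d = D (e, b, x)" by (rule dart_cases[OF d(1)])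
    thus "T \<in> (\<lambda>(e, b). D ` ({e} \<times> {b} \<times> UNIV)) ` (E \<times> UNIV)"
      using d(2) face_D by (intro image_eqI[of _ _ "(e, b)"]) auto
  next
    fix T assume "T \<in> (\<lambda>(e, b). D ` ({e} \<times> {b} \<times> UNIV)) ` (E \<times> UNIV)"
    then obtain e b where e: "e \<in> E" "T = D ` ({e} \<times> {b} \<times> UNIV)" by auto
    hence "T = face H (D (e, b, FarUV))" "D (e, b, FarUV) \<in> darts H"
      using face_D D_in[of "(e, b, FarUV)"] by auto
    thus "T \<in> faces H" by (auto simp: faces_def)
  qed
  moreover have "inj_on (\<lambda>(e, b). D ` ({e} \<times> {b} \<times> UNIV)) (E \<times> UNIV)"
  proof (rule inj_onI)
    fix y z :: "'e \<times> bool"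
    assume yz: "y \<in> E \<times> UNIV" "z \<in> E \<times> UNIV"
      "(\<lambda>(e, b). D ` ({e} \<times> {b} \<times> UNIV)) y = (\<lambda>(e, b). D ` ({e} \<times> {b} \<times> UNIV)) z"
    obtain e b where y: "y = (e, b)" by fastforce
    obtain e' b' where z: "z = (e', b')" by fastforce
    have "D (e, b, FarUV) \<in> D ` ({e'} \<times> {b'} \<times> UNIV)"
      using yz(3) y z by auto
    then obtain w where "D (e, b, FarUV) = D (e', b', w)" by auto
    thus "y = z" using D_eq_iff[of "(e, b, FarUV)" "(e', b', w)"] yz y z by simp
  qed
  ultimately show ?thesis
    using E by (simp add: card_image card_cartesian_product)
qed

definition chamber :: "'e \<Rightarrow> 'd set" where
  "chamber e = D ` ({e} \<times> UNIV)"

lemma chambers_eq: "chambers H = chamber ` E"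
proof -
  have un: "face H (D (e, b, FarUV)) \<union> face H (flip H (D (e, b, FarUV))) = chamber e"
    if e: "e \<in> E" for e b
  proof -
    have "flip H (D (e, b, FarUV)) = D (e, \<not> b, FarUV)"
      using flip_D[of "(e, b, FarUV)"] e by simp
    hence "face H (D (e, b, FarUV)) \<union> face H (flip H (D (e, b, FarUV))) =
        D ` ({e} \<times> {b} \<times> UNIV \<union> {e} \<times> {\<not> b} \<times> UNIV)"
      by (simp add: face_D[OF e] image_Un)
    also have "{e} \<times> {b} \<times> UNIV \<union> {e} \<times> {\<not> b} \<times> UNIV = {e} \<times> (UNIV :: (bool \<times> edge_color) set)"
      by auto
    finally show ?thesis by (simp add: chamber_def)
  qed
  show ?thesis
  proof (intro equalityI subsetI)
    fix C assume "C \<in> chambers H"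
    then obtain d where d: "d \<in> darts H" "edge_color H d = FarUV"
      "C = face H d \<union> face H (flip H d)" by (auto simp: chambers_def)
    obtain e b x where e: "e \<in> E" "d = D (e, b, x)" by (rule dart_cases[OF d(1)])
    thus "C \<in> chamber ` E" using d un edge_color_D[of "(e, b, x)"] by auto
  next
    fix C assume "C \<in> chamber ` E"
    then obtain e where e: "e \<in> E" "C = chamber e" by auto
    hence y: "(e, True, FarUV) \<in> E \<times> UNIV" by simp
    show "C \<in> chambers H"
      unfolding chambers_def e(2)
      using un[OF e(1), of True] D_in[OF y] edge_color_D[OF y] by auto
  qed
qed

lemma inj_chamber: "inj_on chamber E"
proof (rule inj_onI)
  fix e e' assume e: "e \<in> E" "e' \<in> E" "chamber e = chamber e'"
  have "D (e, True, FarUV) \<in> chamber e'" using e(3) by (auto simp: chamber_def)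
  then obtain s where "D (e, True, FarUV) = D (e', s)" by (auto simp: chamber_def)
  thus "e = e'" using D_eq_iff[of "(e, True, FarUV)" "(e', s)"] e by simp
qed

lemma chamber_of_D:
  assumes e: "e \<in> E"
  shows "chamber_of H (D (e, s)) = chamber e"
  unfolding chamber_of_def chambers_eq
proof (rule the_equality)
  show "chamber e \<in> chamber ` E \<and> D (e, s) \<in> chamber e" using e by (auto simp: chamber_def)
  fix C assume "C \<in> chamber ` E \<and> D (e, s) \<in> C"
  then obtain e' s' where "e' \<in> E" "C = chamber e'" "D (e, s) = D (e', s')"
    by (auto simp: chamber_def)
  thus "C = chamber e" using D_eq_iff[of "(e, s)" "(e', s')"] e by simp
qed

lemma chamber_color_chamber: "e \<in> E \<Longrightarrow> chamber_color H (chamber e) = c e"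
  by (simp add: chamber_def chamber_color_D)

lemma colored_checker_surface_iff:
  "colored_checker_surface \<psi> m H \<longleftrightarrow>
     card E = (\<Sum>j=1..\<psi>. m j) \<and> c ` E \<subseteq> {1..\<psi>} \<and> (\<forall>j\<in>{1..\<psi>}. card {e \<in> E. c e = j} = m j)"
proof -
  have "{C \<in> chambers H. chamber_color H C = j} = chamber ` {e \<in> E. c e = j}" for j
    unfolding chambers_eq using chamber_color_chamber by auto
  hence "card {C \<in> chambers H. chamber_color H C = j} = card {e \<in> E. c e = j}" for j
    using inj_on_subset[OF inj_chamber, of "{e \<in> E. c e = j}"] by (simp add: card_image)
  moreover have "chamber_color H ` chambers H = c ` E"
    unfolding chambers_eq image_image using chamber_color_chamber by simp
  ultimately show ?thesis
    by (simp add: colored_checker_surface_def checker_surface card_faces)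
qed

text \<open>
  Two steps around a vertex, starting from a side of the chamber \<open>e\<close>, lead across two edges to the
  corresponding side of another chamber. The steps are clockwise at the vertices on
  \<open>FarUV\<close> edges, and counterclockwise at the others. At a \<open>NearIR\<close>-\<open>MidIR\<close> vertex
  a \<open>NearIR\<close> edge and a \<open>MidIR\<close> edge are crossed, which composes both gluings.
\<close>
lemma alternating_near_far:
  "alternating (inv (rot H)) (\<lambda>e. D (e, False, FarUV)) (\<lambda>d. edge_color H d = FarUV) E q"
proof
  fix e assume e: "e \<in> E"
  have "inv (rot H) (D (e, False, FarUV)) = D (e, True, NearIR)"
    using inv_rot_D[of "(e, False, FarUV)"] e by simp
  moreover have "inv (rot H) (D (e, True, NearIR)) = D (q e, False, FarUV)"
    using inv_rot_D[of "(e, True, NearIR)"] e by simp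
  ultimately show "inv (rot H) (inv (rot H) (D (e, False, FarUV))) = D (q e, False, FarUV)"
    "edge_color H (D (e, False, FarUV)) = FarUV"
    "edge_color H (inv (rot H) (D (e, False, FarUV))) \<noteq> FarUV"
    using edge_color_D[of "(e, False, FarUV)"] edge_color_D[of "(e, True, NearIR)"] e by simp_all
qed (use E q permutation_rot D_eq_iff in \<open>auto simp: inj_on_def\<close>)

lemma alternating_mid_far:
  "alternating (inv (rot H)) (\<lambda>e. D (e, True, FarUV)) (\<lambda>d. edge_color H d = FarUV) E p"
proof
  fix e assume e: "e \<in> E"
  have "inv (rot H) (D (e, True, FarUV)) = D (e, False, MidIR)"
    using inv_rot_D[of "(e, True, FarUV)"] e by simp
  moreover have "inv (rot H) (D (e, False, MidIR)) = D (p e, True, FarUV)"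
    using inv_rot_D[of "(e, False, MidIR)"] e by simp
  ultimately show "inv (rot H) (inv (rot H) (D (e, True, FarUV))) = D (p e, True, FarUV)"
    "edge_color H (D (e, True, FarUV)) = FarUV"
    "edge_color H (inv (rot H) (D (e, True, FarUV))) \<noteq> FarUV"
    using edge_color_D[of "(e, True, FarUV)"] edge_color_D[of "(e, False, MidIR)"] e by simp_all
qed (use E p permutation_rot D_eq_iff in \<open>auto simp: inj_on_def\<close>)

lemma alternating_near_mid:
  "alternating (rot H) (\<lambda>e. D (e, True, MidIR)) (\<lambda>d. plus_triangle H (face H d)) E (p \<circ> q)"
proof
  fix e assume e: "e \<in> E"
  have qe: "q e \<in> E" using e permutes_in_image[OF q] by simp
  have "rot H (D (e, True, MidIR)) = D (q e, False, NearIR)"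
    using rot_D[of "(e, True, MidIR)"] e by simp
  moreover have "rot H (D (q e, False, NearIR)) = D (p (q e), True, MidIR)"
    using rot_D[of "(q e, False, NearIR)"] qe by simp
  ultimately show "rot H (rot H (D (e, True, MidIR))) = D ((p \<circ> q) e, True, MidIR)"
    "plus_triangle H (face H (D (e, True, MidIR)))"
    "\<not> plus_triangle H (face H (rot H (D (e, True, MidIR))))"
    using plus_triangle_D e qe by simp_all
qed (use E permutes_compose[OF q p] permutation_rot D_eq_iff in \<open>auto simp: inj_on_def\<close>)

text \<open>
  The darts around a vertex alternate between two families of sides, each of a single color; so
  the edge colors identify the type of a vertex.
\<close>
lemma edge_colors_vertex:
  assumes e: "e \<in> E"
  shows "edge_color H ` orbit (rot H) (D (e, False, FarUV)) = {NearIR, FarUV}"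
    and "edge_color H ` orbit (rot H) (D (e, True, FarUV)) = {MidIR, FarUV}"
    and "edge_color H ` orbit (rot H) (D (e, True, MidIR)) = {NearIR, MidIR}"
proof -
  interpret nf: alternating "inv (rot H)" "\<lambda>e. D (e, False, FarUV)" "\<lambda>d. edge_color H d = FarUV" E q
    by (rule alternating_near_far)
  interpret mf: alternating "inv (rot H)" "\<lambda>e. D (e, True, FarUV)" "\<lambda>d. edge_color H d = FarUV" E p
    by (rule alternating_mid_far)
  interpret nm: alternating "rot H" "\<lambda>e. D (e, True, MidIR)" "\<lambda>d. plus_triangle H (face H d)" E "p \<circ> q"
    by (rule alternating_near_mid)
  have two: "f ` Z \<union> f' ` Z = S"
    if "Z \<noteq> {}" "\<And>z. z \<in> Z \<Longrightarrow> f z = x" "\<And>z. z \<in> Z \<Longrightarrow> f' z = y" "S = {x, y}"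
    for f f' :: "'e \<Rightarrow> edge_color" and Z x y S
    using that by auto
  have inE: "z \<in> E" if "z \<in> orbit f e" "f permutes E" for f z
    using permutes_orbit_subset[OF that(2) e] that(1) by blast
  show "edge_color H ` orbit (rot H) (D (e, False, FarUV)) = {NearIR, FarUV}"
    unfolding orbit_inv_eq[OF permutation_rot(1), symmetric] nf.orbit_alternating[OF e]
      image_Un image_image
    by (rule two[where x = FarUV and y = NearIR])
      (use inE[OF _ q] in \<open>auto simp: orbit_nonempty inv_rot_D edge_color_D\<close>)
  show "edge_color H ` orbit (rot H) (D (e, True, FarUV)) = {MidIR, FarUV}"
    unfolding orbit_inv_eq[OF permutation_rot(1), symmetric] mf.orbit_alternating[OF e]
      image_Un image_image
    by (rule two[where x = FarUV and y = MidIR])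
      (use inE[OF _ p] in \<open>auto simp: orbit_nonempty inv_rot_D edge_color_D\<close>)
  show "edge_color H ` orbit (rot H) (D (e, True, MidIR)) = {NearIR, MidIR}"
    unfolding nm.orbit_alternating[OF e] image_Un image_image
    by (rule two[where x = MidIR and y = NearIR])
      (use inE[OF _ permutes_compose[OF q p]] permutes_in_image[OF q] in
        \<open>auto simp: orbit_nonempty rot_D edge_color_D\<close>)
qed

lemma vertex_cases:
  assumes "V \<in> vertices H"
  obtains e where "e \<in> E" "V = orbit (rot H) (D (e, False, FarUV))"
  | e where "e \<in> E" "V = orbit (rot H) (D (e, True, FarUV))"
  | e where "e \<in> E" "V = orbit (rot H) (D (e, True, MidIR))"
proof -
  obtain d where d: "d \<in> darts H" "V = orbit (rot H) d" using assms by (auto simp: vertices_def)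
  obtain e b x where e: "e \<in> E" "d = D (e, b, x)" by (rule dart_cases[OF d(1)])
  have step: "orbit (rot H) (rot H d) = orbit (rot H) d" for d
    by (rule permutation_orbit_step[OF permutation_rot(1)])
  consider "b" "x = NearIR" | "b" "x = MidIR" | "b" "x = FarUV"
    | "\<not> b" "x = NearIR" | "\<not> b" "x = MidIR" | "\<not> b" "x = FarUV"
    by (cases x) auto
  thus thesis
  proof cases
    case 1
    have "rot H d = D (e, False, FarUV)" using rot_D[of "(e, b, x)"] e 1 by simp
    thus ?thesis using that(1)[OF e(1)] d(2) step[of d] by simp
  next
    case 4
    have e': "inv q e \<in> E" using e(1) permutes_in_image[OF permutes_inv[OF q]] by simp
    have "rot H (D (inv q e, True, MidIR)) = d"
      using rot_D[of "(inv q e, True, MidIR)"] e e' 4 permutes_inverses(1)[OF q] by simp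
    thus ?thesis using that(3)[OF e'] d(2) step[of "D (inv q e, True, MidIR)"] by simp
  next
    case 5
    have "rot H d = D (e, True, FarUV)" using rot_D[of "(e, b, x)"] e 5 by simp
    thus ?thesis using that(2)[OF e(1)] d(2) step[of d] by simp
  qed (use that e d(2) in auto)
qed

lemma vertices_of_type_eq:
  "vertices_of_type H NearIR FarUV = (\<lambda>e. orbit (rot H) (D (e, False, FarUV))) ` E"
  "vertices_of_type H MidIR FarUV = (\<lambda>e. orbit (rot H) (D (e, True, FarUV))) ` E"
  "vertices_of_type H NearIR MidIR = (\<lambda>e. orbit (rot H) (D (e, True, MidIR))) ` E"
proof -
  have ne: "{NearIR, FarUV} \<noteq> {MidIR, FarUV}" "{NearIR, FarUV} \<noteq> {NearIR, MidIR}"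
    "{MidIR, FarUV} \<noteq> {NearIR, MidIR}" by auto
  define F where "F V = edge_color H ` V" for V
  note F = edge_colors_vertex[folded F_def]
  have vert: "orbit (rot H) (D (e, s)) \<in> vertices H" if "e \<in> E" for e s
    using D_in[of "(e, s)"] that by (auto simp: vertices_def)
  show "vertices_of_type H NearIR FarUV = (\<lambda>e. orbit (rot H) (D (e, False, FarUV))) ` E"
    "vertices_of_type H MidIR FarUV = (\<lambda>e. orbit (rot H) (D (e, True, FarUV))) ` E"
    "vertices_of_type H NearIR MidIR = (\<lambda>e. orbit (rot H) (D (e, True, MidIR))) ` E"
    unfolding vertices_of_type_def F_def[symmetric]
    using ne ne[symmetric] vert by (auto simp: F elim!: vertex_cases)
qed

lemma near_far_neck_mess_eq: "near_far_neck_mess H = cycle_neck_mess E c q"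
  unfolding near_far_neck_mess_def vertices_of_type_eq vertex_necklace_def
    orbit_inv_eq[OF permutation_rot(1), symmetric]
  by (rule alternating.cycle_neck_mess_alternating[OF alternating_near_far])
    (simp add: chamber_of_D chamber_color_chamber)

lemma mid_far_neck_mess_eq: "mid_far_neck_mess H = cycle_neck_mess E c p"
  unfolding mid_far_neck_mess_def vertices_of_type_eq vertex_necklace_def
    orbit_inv_eq[OF permutation_rot(1), symmetric]
  by (rule alternating.cycle_neck_mess_alternating[OF alternating_mid_far])
    (simp add: chamber_of_D chamber_color_chamber)

lemma plus_near_mid_neck_mess_eq: "plus_near_mid_neck_mess H = cycle_neck_mess E c (p \<circ> q)"
  unfolding plus_near_mid_neck_mess_def vertices_of_type_eq vertex_necklace_def
  by (rule alternating.cycle_neck_mess_alternating[OF alternating_near_mid])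
    (simp add: chamber_of_D chamber_color_chamber)

end

section \<open>Isomorphisms of surfaces and of their labels\<close>

definition pair_isos ::
  "'e set \<Rightarrow> ('e \<Rightarrow> nat) \<Rightarrow> ('e \<Rightarrow> 'e) \<Rightarrow> ('e \<Rightarrow> 'e) \<Rightarrow>
   'f set \<Rightarrow> ('f \<Rightarrow> nat) \<Rightarrow> ('f \<Rightarrow> 'f) \<Rightarrow> ('f \<Rightarrow> 'f) \<Rightarrow> ('e \<Rightarrow> 'f) set" where
  "pair_isos E c p q E' c' p' q' = perm_isos E c p E' c' p' \<inter> perm_isos E c q E' c' q'"

lemma perm_isos_inv_perm:
  assumes f: "f \<in> perm_isos A c g B d h" and g: "g permutes A" and h: "h permutes B" and x: "x \<in> A"
  shows "f (inv g x) = inv h (f x)"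
proof -
  have "inv g x \<in> A" using permutes_in_image[OF permutes_inv[OF g]] x by simp
  hence "h (f (inv g x)) = f x"
    using f permutes_inverses(1)[OF g, of x] by (auto simp: perm_isos_def dest: bspec[of A _ "inv g x"])
  thus ?thesis using permutes_inv_eq[OF h] by metis
qed

lemma side_flip_apfst:
  assumes \<phi>: "\<phi> \<in> pair_isos E c p q E' c' p' q'"
    and p: "p permutes E" "p' permutes E'" and q: "q permutes E" "q' permutes E'"
    and y: "y \<in> E \<times> UNIV"
  shows "side_flip p' q' (apfst \<phi> y) = apfst \<phi> (side_flip p q y)"
proof -
  have P: "\<phi> \<in> perm_isos E c p E' c' p'" and Q: "\<phi> \<in> perm_isos E c q E' c' q'"
    using \<phi> by (simp_all add: pair_isos_def)
  have "\<phi> (p e) = p' (\<phi> e)" "\<phi> (q e) = q' (\<phi> e)" "\<phi> (inv p e) = inv p' (\<phi> e)"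
    "\<phi> (inv q e) = inv q' (\<phi> e)" if "e \<in> E" for e
    using P Q that perm_isos_inv_perm[OF P p that] perm_isos_inv_perm[OF Q q that]
    by (simp_all add: perm_isos_def)
  thus ?thesis using y by (cases "(p, q, y)" rule: side_flip.cases) auto
qed

lemma side_next_apfst: "side_next (apfst \<phi> y) = apfst \<phi> (side_next y)"
  by (cases y) simp

text \<open>
  Labels can be pulled back along an isomorphism, which lets the elements of \<open>\<Omega>\<close> take the
  place of the chambers of a given surface.
\<close>
lemma (in surface_chart) rechart:
  assumes \<phi>: "\<phi> \<in> pair_isos E0 c0 p0 q0 E c p q" and p0: "p0 permutes E0" and q0: "q0 permutes E0"
  shows "surface_chart H E0 p0 q0 c0 (D \<circ> apfst \<phi>)"
proof -
  have \<phi>b: "bij_betw \<phi> E0 E" using \<phi> by (simp add: pair_isos_def perm_isos_def)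
  have \<phi>c: "c (\<phi> e) = c0 e" if "e \<in> E0" for e
    using \<phi> that by (simp add: pair_isos_def perm_isos_def)
  have \<phi>E: "\<phi> e \<in> E" if "e \<in> E0" for e using \<phi>b that by (auto simp: bij_betw_def)
  have "bij_betw (apfst \<phi>) (E0 \<times> UNIV) (E \<times> (UNIV :: (bool \<times> edge_color) set))"
    using \<phi>b by (auto simp: bij_betw_def inj_on_def image_iff)
  hence b: "bij_betw (D \<circ> apfst \<phi>) (E0 \<times> UNIV) (darts H)" using D by (rule bij_betw_trans)
  have in_E: "apfst \<phi> y \<in> E \<times> UNIV" if "y \<in> E0 \<times> UNIV" for y using that \<phi>E by auto
  have ch: "(D \<circ> apfst \<phi>) ` ({e} \<times> UNIV) = D ` ({\<phi> e} \<times> UNIV)" for e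
  proof -
    have "apfst \<phi> ` ({e} \<times> UNIV) = {\<phi> e} \<times> (UNIV :: (bool \<times> edge_color) set)" by force
    thus ?thesis by (metis image_comp)
  qed
  show ?thesis
  proof
    show "finite E0" using E bij_betw_finite[OF \<phi>b] by simp
    show "chamber_color H ((D \<circ> apfst \<phi>) ` ({e} \<times> UNIV)) = c0 e" if "e \<in> E0" for e
      unfolding ch using chamber_color_D[OF \<phi>E[OF that]] \<phi>c[OF that] by simp
    fix y :: "'a \<times> bool \<times> edge_color" assume y: "y \<in> E0 \<times> UNIV"
    show "face_next H ((D \<circ> apfst \<phi>) y) = (D \<circ> apfst \<phi>) (side_next y)"
      using face_next_D[OF in_E[OF y]] by (simp add: side_next_apfst)
    show "flip H ((D \<circ> apfst \<phi>) y) = (D \<circ> apfst \<phi>) (side_flip p0 q0 y)"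
      using flip_D[OF in_E[OF y]] side_flip_apfst[OF \<phi> p0 p q0 q y] by simp
    show "edge_color H ((D \<circ> apfst \<phi>) y) = snd (snd y)"
      using edge_color_D[OF in_E[OF y]] by simp
  qed (use p0 q0 rot flip b in simp_all)
qed

definition chart_map ::
  "'e set \<Rightarrow> ('e \<times> bool \<times> edge_color \<Rightarrow> 'd) \<Rightarrow> ('f \<times> bool \<times> edge_color \<Rightarrow> 'g) \<Rightarrow> ('e \<Rightarrow> 'f) \<Rightarrow> 'd \<Rightarrow> 'g"
where
  "chart_map E D D' \<phi> = (\<lambda>d \<in> D ` (E \<times> UNIV). D' (apfst \<phi> (inv_into (E \<times> UNIV) D d)))"

text \<open>
  An isomorphism of surfaces preserves the side of a dart within its chamber: the color of the
  side is preserved by definition, and the sign of its triangle is visible from the color of the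
  next side. It is thus given by a bijection of the chambers, which respects the gluing
  permutations and the colors of the chambers; conversely, such a bijection of labels preserves
  all the structure. Surfaces with chamber colors are in this way the same as colored
  sets with a pair of permutations.
\<close>
lemma bij_betw_chart_map:
  fixes H :: "'d surface" and H' :: "'g surface"
  assumes "surface_chart H E p q c D" and "surface_chart H' E' p' q' c' D'"
  shows "bij_betw (chart_map E D D') (pair_isos E c p q E' c' p' q') (surface_isos H H')"
proof -
  interpret h: surface_chart H E p q c D by fact
  interpret h': surface_chart H' E' p' q' c' D' by fact
  have inj: "inj_on D (E \<times> UNIV)" and darts: "darts H = D ` (E \<times> UNIV)"
    using h.D by (auto simp: bij_betw_def)
  have map_D: "chart_map E D D' \<phi> (D y) = D' (apfst \<phi> y)" if "y \<in> E \<times> UNIV" for \<phi> y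
    using that inv_into_f_f[OF inj that] by (auto simp: chart_map_def)
  have ext: "chart_map E D D' \<phi> \<in> extensional (darts H)" for \<phi>
    by (simp add: chart_map_def darts)
  show ?thesis
  proof (rule bij_betw_imageI)
    show "inj_on (chart_map E D D') (pair_isos E c p q E' c' p' q')"
    proof (rule inj_onI)
      fix \<phi> \<psi> assume iso: "\<phi> \<in> pair_isos E c p q E' c' p' q'" "\<psi> \<in> pair_isos E c p q E' c' p' q'"
        and eq: "chart_map E D D' \<phi> = chart_map E D D' \<psi>"
      have \<phi>: "\<phi> \<in> E \<rightarrow>\<^sub>E E'" and \<psi>: "\<psi> \<in> E \<rightarrow>\<^sub>E E'"
        using iso by (auto simp: pair_isos_def perm_isos_def)
      show "\<phi> = \<psi>"
      proof (rule PiE_ext[OF \<phi> \<psi>])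
        fix e assume e: "e \<in> E"
        have "D' (\<phi> e, True, FarUV) = D' (\<psi> e, True, FarUV)"
          using fun_cong[OF eq, of "D (e, True, FarUV)"] map_D[of "(e, True, FarUV)"] e by simp
        thus "\<phi> e = \<psi> e"
          using h'.D_eq_iff[of "(\<phi> e, True, FarUV)" "(\<psi> e, True, FarUV)"] PiE_mem[OF \<phi> e] PiE_mem[OF \<psi> e]
          by simp
      qed
    qed
    show "chart_map E D D' ` pair_isos E c p q E' c' p' q' = surface_isos H H'"
    proof (intro equalityI subsetI)
      fix k assume "k \<in> chart_map E D D' ` pair_isos E c p q E' c' p' q'"
      then obtain \<phi> where \<phi>: "\<phi> \<in> pair_isos E c p q E' c' p' q'" and k: "k = chart_map E D D' \<phi>"
        by auto
      interpret r: surface_chart H' E p q c "D' \<circ> apfst \<phi>"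
        by (rule h'.rechart[OF \<phi> h.p h.q])
      have kD: "k (D y) = (D' \<circ> apfst \<phi>) y" if "y \<in> E \<times> UNIV" for y using map_D[OF that] k by simp
      have "bij_betw (k \<circ> D) (E \<times> UNIV) (darts H')"
        using bij_betw_cong[of "E \<times> UNIV" "k \<circ> D" "D' \<circ> apfst \<phi>" "darts H'"] kD r.D by simp
      hence bij: "bij_betw k (darts H) (darts H')"
        using bij_betw_comp_iff[OF h.D] by blast
      have kC: "k ` h.chamber e = r.chamber e" if "e \<in> E" for e
        unfolding h.chamber_def r.chamber_def image_image
        by (rule image_cong[OF refl]) (use kD that in auto)
      show "k \<in> surface_isos H H'"
        unfolding surface_isos_def
      proof (intro CollectI conjI ballI)
        show "k \<in> darts H \<rightarrow>\<^sub>E darts H'"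
          using bij ext[of \<phi>] k by (auto simp: PiE_def bij_betw_def)
        show "chamber_color H' (k ` C) = chamber_color H C" if "C \<in> chambers H" for C
          using that unfolding h.chambers_eq
          by (auto simp: kC r.chamber_color_chamber h.chamber_color_chamber)
        fix d assume "d \<in> darts H"
        then obtain y where y: "y \<in> E \<times> UNIV" "d = D y" using darts by auto
        have y2: "side_flip p q (side_next (side_next y)) \<in> E \<times> UNIV"
          using y(1) h.side_flip_in_E by (simp only: side_next_in)
        show "k (rot H d) = rot H' (k d)"
          using h.rot_D[OF y(1)] r.rot_D[OF y(1)] kD[OF y(1)] kD[OF y2] y(2) by simp
        show "k (flip H d) = flip H' (k d)"
          using h.flip_D[OF y(1)] r.flip_D[OF y(1)] kD[OF y(1)] kD[OF h.side_flip_in_E[OF y(1)]] y(2)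
          by simp
        show "edge_color H' (k d) = edge_color H d"
          using h.edge_color_D[OF y(1)] r.edge_color_D[OF y(1)] kD[OF y(1)] y(2) by simp
      qed (use bij in simp)
    next
      fix k assume "k \<in> surface_isos H H'"
      hence k: "k \<in> darts H \<rightarrow>\<^sub>E darts H'" "bij_betw k (darts H) (darts H')"
        "\<And>d. d \<in> darts H \<Longrightarrow> k (rot H d) = rot H' (k d)"
        "\<And>d. d \<in> darts H \<Longrightarrow> k (flip H d) = flip H' (k d)"
        "\<And>d. d \<in> darts H \<Longrightarrow> edge_color H' (k d) = edge_color H d"
        "\<And>C. C \<in> chambers H \<Longrightarrow> chamber_color H' (k ` C) = chamber_color H C"
        by (simp_all add: surface_isos_def)
      \<comment> \<open>Once \<open>k\<close> is known on one side of a chamber, it is known on the adjacent sides.\<close>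
      have kflip: "k (D (side_flip p q y)) = D' (side_flip p' q' y')"
        if "y \<in> E \<times> UNIV" "y' \<in> E' \<times> UNIV" "k (D y) = D' y'" for y y'
        using that k(4)[OF h.D_in[OF that(1)]] h.flip_D h'.flip_D by simp
      have knext: "k (D (side_next y)) = D' (side_next y')"
        if "y \<in> E \<times> UNIV" "y' \<in> E' \<times> UNIV" "k (D y) = D' y'" for y y'
      proof -
        have y2: "side_next y \<in> E \<times> UNIV" using that(1) by (simp only: side_next_in)
        have "rot H (D (side_next y)) = flip H (D y)"
          using h.rot_D[OF y2] h.flip_D[OF that(1)] by (simp add: side_next_cycle)
        hence "rot H' (k (D (side_next y))) = flip H' (D' y')"
          using k(3)[OF h.D_in[OF y2]] k(4)[OF h.D_in[OF that(1)]] that(3) by simp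
        moreover have "rot H' (D' (side_next y')) = flip H' (D' y')"
          using that(2) h'.rot_D[of "side_next y'"] h'.flip_D[OF that(2)]
          by (simp add: side_next_cycle side_next_in)
        ultimately show ?thesis using permutes_inj[OF h'.rot] by (metis injD)
      qed
      \<comment> \<open>The side after a \<open>FarUV\<close> side has color \<open>NearIR\<close> exactly in a plus-triangle.\<close>
      have "\<exists>e'\<in>E'. k (D (e, True, FarUV)) = D' (e', True, FarUV)" if e: "e \<in> E" for e
      proof -
        let ?y = "(e, True, FarUV)"
        have y: "?y \<in> E \<times> UNIV" "D ?y \<in> darts H" "(e, True, NearIR) \<in> E \<times> UNIV"
            "D (e, True, NearIR) \<in> darts H"
          using e h.D_in by auto
        have "k (D ?y) \<in> darts H'" using PiE_mem[OF k(1) y(2)] .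
        then obtain e' b' x' where e': "e' \<in> E'" "k (D ?y) = D' (e', b', x')" by (rule h'.dart_cases)
        have x': "x' = FarUV"
          using k(5)[OF y(2)] h.edge_color_D[OF y(1)] h'.edge_color_D[of "(e', b', x')"] e' by simp
        have "k (D (e, True, NearIR)) = D' (side_next (e', b', x'))"
          using knext[OF y(1) _ e'(2)] e'(1) by simp
        hence "snd (snd (side_next (e', b', x'))) = NearIR"
          using k(5)[OF y(4)] h.edge_color_D[OF y(3)] h'.edge_color_D[of "side_next (e', b', x')"] e'(1)
          by (simp add: side_next_in)
        hence b' using x' by (simp split: if_splits)
        thus ?thesis using e' x' by auto
      qed
      then obtain \<phi>0 where \<phi>0: "\<And>e. e \<in> E \<Longrightarrow> \<phi>0 e \<in> E'"
        "\<And>e. e \<in> E \<Longrightarrow> k (D (e, True, FarUV)) = D' (\<phi>0 e, True, FarUV)" by metis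
      define \<phi> where "\<phi> = restrict \<phi>0 E"
      have \<phi>E: "\<phi> e \<in> E'" if "e \<in> E" for e using \<phi>0(1) that by (simp add: \<phi>_def)
      have kD: "k (D (e, b, x)) = D' (\<phi> e, b, x)" if e: "e \<in> E" for e b x
      proof -
        have in_E: "(e, s) \<in> E \<times> UNIV" "(\<phi> e, s) \<in> E' \<times> UNIV" for s using e \<phi>E by auto
        have TF: "k (D (e, True, FarUV)) = D' (\<phi> e, True, FarUV)" using \<phi>0(2) e by (simp add: \<phi>_def)
        have TN: "k (D (e, True, NearIR)) = D' (\<phi> e, True, NearIR)" using knext[OF in_E TF] by simp
        have TM: "k (D (e, True, MidIR)) = D' (\<phi> e, True, MidIR)" using knext[OF in_E TN] by simp
        have FF: "k (D (e, False, FarUV)) = D' (\<phi> e, False, FarUV)" using kflip[OF in_E TF] by simp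
        have FM: "k (D (e, False, MidIR)) = D' (\<phi> e, False, MidIR)" using knext[OF in_E FF] by simp
        have FN: "k (D (e, False, NearIR)) = D' (\<phi> e, False, NearIR)" using knext[OF in_E FM] by simp
        show ?thesis using TF TN TM FF FM FN by (cases x; cases b) simp_all
      qed
      have D'_eq: "e1 = e2" if "D' (e1, s) = D' (e2, s)" "e1 \<in> E'" "e2 \<in> E'" for e1 e2 s
        using h'.D_eq_iff[of "(e1, s)" "(e2, s)"] that by simp
      have \<phi>q: "\<phi> (q e) = q' (\<phi> e)" if e: "e \<in> E" for e
      proof -
        have qe: "q e \<in> E" using permutes_in_image[OF h.q] e by simp
        have "D' (\<phi> (q e), False, NearIR) = D' (q' (\<phi> e), False, NearIR)"
          using kflip[OF _ _ kD[OF e, of True NearIR]] e \<phi>E[OF e] kD[OF qe] by simp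
        thus ?thesis using D'_eq \<phi>E[OF qe] \<phi>E[OF e] permutes_in_image[OF h'.q] by metis
      qed
      have \<phi>p: "\<phi> (p e) = p' (\<phi> e)" if e: "e \<in> E" for e
      proof -
        have pe: "p e \<in> E" using permutes_in_image[OF h.p] e by simp
        have "D' (\<phi> (p e), True, MidIR) = D' (p' (\<phi> e), True, MidIR)"
          using kflip[OF _ _ kD[OF e, of False MidIR]] e \<phi>E[OF e] kD[OF pe] by simp
        thus ?thesis using D'_eq \<phi>E[OF pe] \<phi>E[OF e] permutes_in_image[OF h'.p] by metis
      qed
      have \<phi>c: "c' (\<phi> e) = c e" if e: "e \<in> E" for e
      proof -
        have "k ` h.chamber e = h'.chamber (\<phi> e)"
          using kD[OF e] by (force simp: h.chamber_def h'.chamber_def image_iff)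
        thus ?thesis
          using k(6)[of "h.chamber e"] h.chambers_eq h.chamber_color_chamber[OF e]
            h'.chamber_color_chamber[OF \<phi>E[OF e]] e by simp
      qed
      have "inj_on \<phi> E"
      proof (rule inj_onI)
        fix e1 e2 assume e: "e1 \<in> E" "e2 \<in> E" "\<phi> e1 = \<phi> e2"
        let ?s = "(True, FarUV)"
        have "k (D (e1, ?s)) = k (D (e2, ?s))" using kD e by simp
        hence "D (e1, ?s) = D (e2, ?s)"
          using k(2) h.D_in[of "(e1, ?s)"] h.D_in[of "(e2, ?s)"] e by (auto simp: bij_betw_def inj_on_def)
        thus "e1 = e2" using h.D_eq_iff[of "(e1, ?s)" "(e2, ?s)"] e by simp
      qed
      moreover have "E' \<subseteq> \<phi> ` E"
      proof
        fix e' assume e': "e' \<in> E'"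
        have "D' (e', True, FarUV) \<in> k ` darts H"
          using h'.D_in[of "(e', True, FarUV)"] e' k(2) by (simp add: bij_betw_def)
        then obtain d where d: "d \<in> darts H" "D' (e', True, FarUV) = k d" by auto
        obtain e b x where e: "e \<in> E" "d = D (e, b, x)" by (rule h.dart_cases[OF d(1)])
        hence "e' = \<phi> e"
          using d(2) kD[OF e(1)] h'.D_eq_iff[of "(e', True, FarUV)" "(\<phi> e, b, x)"] e' \<phi>E[OF e(1)] by simp
        thus "e' \<in> \<phi> ` E" using e(1) by simp
      qed
      moreover have "\<phi> \<in> E \<rightarrow>\<^sub>E E'" using \<phi>0(1) by (auto simp: \<phi>_def)
      ultimately have "\<phi> \<in> pair_isos E c p q E' c' p' q'"
        using \<phi>c \<phi>p \<phi>q \<phi>E by (auto simp: pair_isos_def perm_isos_def bij_betw_def)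
      moreover have "k = chart_map E D D' \<phi>"
      proof (rule extensionalityI)
        show "k \<in> extensional (darts H)" using k(1) by (simp add: PiE_def)
        show "chart_map E D D' \<phi> \<in> extensional (darts H)" by (rule ext)
        fix d assume d: "d \<in> darts H"
        obtain e b x where e: "e \<in> E" "d = D (e, b, x)" by (rule h.dart_cases[OF d])
        thus "k d = chart_map E D D' \<phi> d" using map_D[of "(e, b, x)"] kD by simp
      qed
      ultimately show "k \<in> chart_map E D D' ` pair_isos E c p q E' c' p' q'" by blast
    qed
  qed
qed

section \<open>Existence of surfaces and of labellings\<close>

text \<open>
  Every gluing pattern is realized: transport the operations on triples to the natural
  numbers by an injection of the finitely many triples. The rotation must lead back from
  \<^const>\<open>face_next\<close> of a dart to its \<^const>\<open>flip\<close>; since \<^const>\<open>side_next\<close> has order three, the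
  rotation is \<^const>\<open>side_flip\<close> after two steps of \<^const>\<open>side_next\<close>.
\<close>
lemma exists_surface:
  fixes E :: "'e set"
  assumes E: "finite E" and p: "p permutes E" and q: "q permutes E"
  shows "\<exists>(H :: nat surface) D. surface_chart H E p q c D"
proof -
  let ?S = "E \<times> (UNIV :: (bool \<times> edge_color) set)"
  have "finite (UNIV :: edge_color set)" by (simp add: UNIV_edge_color[of FarUV])
  hence "finite ?S" using E by (simp add: finite_prod)
  then obtain D :: "'e \<times> bool \<times> edge_color \<Rightarrow> nat" where D: "inj_on D ?S"
    using finite_imp_inj_to_nat_seg by blast
  define dec where "dec = inv_into ?S D"
  have dec: "dec (D y) = y" if "y \<in> ?S" for y using that D by (simp add: dec_def)
  define tr where "tr f = restrict_id (\<lambda>d. D (f (dec d))) (D ` ?S)" for f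
  have tr_D: "tr f (D y) = D (f y)" if "y \<in> ?S" for f y using that dec by (simp add: tr_def)
  have tr_perm: "tr f permutes D ` ?S" if "bij_betw f ?S ?S" for f
  proof -
    have "bij_betw (D \<circ> (f \<circ> dec)) (D ` ?S) (D ` ?S)"
      by (intro bij_betw_trans[of _ _ ?S] that)
        (use D in \<open>auto simp: dec_def intro: bij_betw_inv_into inj_on_imp_bij_betw\<close>)
    thus ?thesis unfolding tr_def by (intro permutes_restrict_id) (simp add: o_def)
  qed
  define sr where "sr y = side_flip p q (side_next (side_next y))" for y
  have bf: "bij_betw (side_flip p q) ?S ?S"
    by (rule bij_betw_byWitness[where f' = "side_flip p q"])
      (use side_flip_in[OF p q] side_flip_flip[OF p q] in blast)+
  have sr_in: "sr y \<in> ?S" if "y \<in> ?S" for y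
    unfolding sr_def using side_flip_in[OF p q] side_next_in that by metis
  have br: "bij_betw sr ?S ?S"
  proof (rule bij_betw_byWitness[where f' = "\<lambda>y. side_next (side_flip p q y)"])
    show "\<forall>y\<in>?S. side_next (side_flip p q (sr y)) = y"
      by (simp add: sr_def side_flip_flip[OF p q] side_next_cycle)
    show "\<forall>y\<in>?S. sr (side_next (side_flip p q y)) = y"
      by (simp add: sr_def side_flip_flip[OF p q] side_next_cycle)
    show "sr ` ?S \<subseteq> ?S" using sr_in by blast
    show "(\<lambda>y. side_next (side_flip p q y)) ` ?S \<subseteq> ?S"
      using side_flip_in[OF p q] side_next_in by blast
  qed
  define ch where "ch e = D ` ({e} \<times> UNIV)" for e
  have inj_ch: "inj_on ch E"
  proof (rule inj_onI)
    fix e e' assume e: "e \<in> E" "e' \<in> E" "ch e = ch e'"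
    have "D (e, True, FarUV) \<in> ch e'" using e(3) by (auto simp: ch_def)
    then obtain s where "D (e, True, FarUV) = D (e', s)" by (auto simp: ch_def)
    hence "(e, True, FarUV) = (e', s)" using D e by (auto dest: inj_onD)
    thus "e = e'" by simp
  qed
  define H where "H = \<lparr>darts = D ` ?S, rot = tr sr, flip = tr (side_flip p q),
    edge_color = (\<lambda>d. snd (snd (dec d))), chamber_color = (\<lambda>C. c (inv_into E ch C))\<rparr>"
  have rot: "rot H permutes darts H" using tr_perm[OF br] by (simp add: H_def)
  have "surface_chart H E p q c D"
  proof
    show "face_next H (D y) = D (side_next y)" if y: "y \<in> ?S" for y
    proof -
      have "rot H (D (side_next y)) = flip H (D y)"
        using tr_D y by (simp add: H_def sr_def side_next_cycle side_next_in)
      thus ?thesis using permutes_inv_eq[OF rot] by (simp add: face_next_def)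
    qed
    show "chamber_color H (D ` ({e} \<times> UNIV)) = c e" if "e \<in> E" for e
      using inv_into_f_f[OF inj_ch that] by (simp add: H_def ch_def)
  qed (use E p q rot tr_perm[OF bf] D tr_D dec in
      \<open>simp_all add: H_def inj_on_imp_bij_betw\<close>)
  thus ?thesis by blast
qed

text \<open>
  Every checker triangulated surface can be labelled, by the \<open>FarUV\<close> darts of its
  plus-triangles, one for each chamber. The other sides of the chamber are reached by going around
  its two triangles, and the gluing permutations \<open>q0\<close>, \<open>p0\<close> are read off by crossing a
  \<open>NearIR\<close> or \<open>MidIR\<close> edge and returning to the \<open>FarUV\<close> edge.
\<close>
lemma exists_chart:
  fixes H :: "'d surface"
  assumes H: "checker_surface H"
  shows "\<exists>(E :: 'd set) p q c D. surface_chart H E p q c D"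
proof -
  let ?n = "face_next H" and ?f = "flip H" and ?c = "edge_color H"
  let ?plus = "\<lambda>d. plus_triangle H (face H d)" and ?minus = "\<lambda>d. minus_triangle H (face H d)"
  have fin: "finite (darts H)" and rot: "rot H permutes darts H" and flip: "?f permutes darts H"
    using H by (simp_all add: checker_surface_def)
  have ff: "?f (?f d) = d" and fc: "?c (?f d) = ?c d" and fpm: "?plus d \<longleftrightarrow> ?minus (?f d)"
    and tri: "?plus d \<or> ?minus d" if "d \<in> darts H" for d
    using H that by (auto simp: checker_surface_def faces_def)
  have n: "?n permutes darts H"
    unfolding face_next_def by (rule permutes_compose[OF flip permutes_inv[OF rot]])
  have perm_n: "permutation ?n" using n fin by (auto simp: permutation_permutes)
  have n_in: "?n d \<in> darts H \<longleftrightarrow> d \<in> darts H" and f_in: "?f d \<in> darts H \<longleftrightarrow> d \<in> darts H" for d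
    using permutes_in_image[OF n] permutes_in_image[OF flip] by auto
  have face_n: "face H (?n d) = face H d" for d
    unfolding face_def by (rule permutation_orbit_step[OF perm_n])
  have self: "d \<in> face H d" for d
    unfolding face_def by (rule permutation_self_in_orbit[OF perm_n])
  have plus_c: "?c (?n d) = next_color (?c d)" if "?plus d" for d
    using that self by (auto simp: plus_triangle_def)
  have minus_c: "?c (?n d) = next_color (next_color (?c d))" if "?minus d" for d
  proof -
    have "?c d = next_color (?c (?n d))" using that self by (auto simp: minus_triangle_def)
    thus ?thesis by (simp add: next_color_cycle)
  qed
  have not_both: "\<not> (?plus d \<and> ?minus d)" for d
    using plus_c[of d] minus_c[of d] next_color_neq[of "next_color (?c d)"] by metis
  have minus_iff: "?minus d \<longleftrightarrow> \<not> ?plus d" if "d \<in> darts H" for d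
    using tri[OF that] not_both by blast
  have plus_f: "?plus (?f d) \<longleftrightarrow> \<not> ?plus d" if "d \<in> darts H" for d
    using fpm[OF that] minus_iff f_in that by blast
  have nc: "?c (?n d) = (if ?plus d then next_color (?c d) else next_color (next_color (?c d)))"
    if "d \<in> darts H" for d
    using plus_c minus_c minus_iff[OF that] by simp
  have inj_n: "?n x = ?n y \<longleftrightarrow> x = y" and inj_f: "?f x = ?f y \<longleftrightarrow> x = y" for x y
    using permutes_inj[OF n] permutes_inj[OF flip] by (auto dest: injD)
  \<comment> \<open>The third dart after \<open>d\<close> has the color of \<open>d\<close>, and no other dart of the triangle does.\<close>
  have n3: "?n (?n (?n d)) = d" if d: "d \<in> darts H" for d
  proof -
    let ?T = "face H d"
    have card: "card ?T = 3" using tri[OF d] by (auto simp: plus_triangle_def minus_triangle_def)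
    have T: "?n x \<in> ?T" if "x \<in> ?T" for x using that unfolding face_def by (rule orbit.step)
    have col: "?c d \<noteq> ?c (?n d)" "?c d \<noteq> ?c (?n (?n d))" "?c (?n d) \<noteq> ?c (?n (?n d))"
      "?c (?n (?n (?n d))) = ?c d"
      using d by (auto simp: nc n_in face_n next_color_neq next_color_cycle)
    have "{d, ?n d, ?n (?n d)} \<subseteq> ?T" using T self by auto
    moreover have "card {d, ?n d, ?n (?n d)} = 3" using col by (auto simp: card_insert_if)
    ultimately have "?T = {d, ?n d, ?n (?n d)}"
      using card by (metis card_subset_eq card.infinite zero_neq_numeral)
    moreover have "?n (?n (?n d)) \<in> ?T" using T self by blast
    ultimately show ?thesis using col by auto
  qed
  define E where "E = {d \<in> darts H. ?c d = FarUV \<and> ?plus d}"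
  define q0 where "q0 e = ?f (?n (?f (?n e)))" for e
  define p0 where "p0 e = ?n (?f (?n (?f e)))" for e
  have E: "e \<in> darts H" "?c e = FarUV" "?plus e" if "e \<in> E" for e using that by (auto simp: E_def)
  have q0: "q0 e \<in> E" and p0: "p0 e \<in> E" if "e \<in> E" for e
    using E[OF that] by (simp_all add: E_def q0_def p0_def nc fc plus_f n_in f_in face_n)
  have finE: "finite E" using fin by (simp add: E_def)
  have "bij_betw q0 E E" "bij_betw p0 E E"
  proof -
    have "q0 ` E \<subseteq> E" "p0 ` E \<subseteq> E" "inj_on q0 E" "inj_on p0 E"
      using q0 p0 by (auto simp: inj_on_def q0_def p0_def inj_n inj_f)
    thus "bij_betw q0 E E" "bij_betw p0 E E"
      using endo_inj_surj[OF finE] by (auto simp: bij_betw_def)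
  qed
  define q p where "q = restrict_id q0 E" and "p = restrict_id p0 E"
  have q: "q permutes E" and p: "p permutes E"
    unfolding q_def p_def by (rule permutes_restrict_id; fact)+
  define D where "D = (\<lambda>(e, b, x).
    let d = (if b then e else ?f e) in
    case x of FarUV \<Rightarrow> d | NearIR \<Rightarrow> if b then ?n d else ?n (?n d)
      | MidIR \<Rightarrow> if b then ?n (?n d) else ?n d)"
  have D: "D (e, True, FarUV) = e" "D (e, True, NearIR) = ?n e" "D (e, True, MidIR) = ?n (?n e)"
    "D (e, False, FarUV) = ?f e" "D (e, False, MidIR) = ?n (?f e)" "D (e, False, NearIR) = ?n (?n (?f e))"
    for e by (simp_all add: D_def)
  have D_in: "D (e, b, x) \<in> darts H" and D_c: "?c (D (e, b, x)) = x" and D_plus: "?plus (D (e, b, x)) \<longleftrightarrow> b"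
    if "e \<in> E" for e b x
    using E[OF that] by (cases b; cases x; simp add: D nc fc plus_f n_in f_in face_n)+
  have D_inj: "e = e'" if "D (e, s) = D (e', s)" for e e' s
    using that by (cases s; cases "fst s"; cases "snd s") (auto simp: D inj_n inj_f)
  have nxt: "?n (D y) = D (side_next y)" if y: "y \<in> E \<times> UNIV" for y
  proof -
    obtain e b x where "y = (e, b, x)" "e \<in> E" using y by auto
    thus ?thesis using E[of e] n3 f_in by (cases b; cases x) (simp_all add: D)
  qed
  have qe: "?f (D (e, True, NearIR)) = D (q e, False, NearIR)"
    and pe: "?f (D (e, False, MidIR)) = D (p e, True, MidIR)" if e: "e \<in> E" for e
    using E[OF e] q0[OF e] p0[OF e] e
    by (simp_all add: D q_def p_def q0_def p0_def ff n_in f_in n3)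
  have flp: "?f (D y) = D (side_flip p q y)" if y: "y \<in> E \<times> UNIV" for y
  proof -
    obtain e b x where e: "y = (e, b, x)" "e \<in> E" using y by auto
    have iq: "inv q e \<in> E" "q (inv q e) = e" and ip: "inv p e \<in> E" "p (inv p e) = e"
      using e(2) permutes_in_image[OF permutes_inv[OF q]] permutes_in_image[OF permutes_inv[OF p]]
        permutes_inverses(1)[OF q] permutes_inverses(1)[OF p] by auto
    have "?f (D (e, False, NearIR)) = D (inv q e, True, NearIR)"
      using qe[OF iq(1)] ff[OF D_in[OF iq(1)]] iq(2) by metis
    moreover have "?f (D (e, True, MidIR)) = D (inv p e, False, MidIR)"
      using pe[OF ip(1)] ff[OF D_in[OF ip(1)]] ip(2) by metis
    moreover have "?f (D (e, b, FarUV)) = D (e, \<not> b, FarUV)"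
      using ff[OF E(1)[OF e(2)]] by (cases b) (simp_all add: D)
    ultimately show ?thesis
      using e qe[OF e(2)] pe[OF e(2)] by (cases b; cases x) simp_all
  qed
  have "bij_betw D (E \<times> UNIV) (darts H)"
  proof (rule bij_betw_imageI)
    show "inj_on D (E \<times> UNIV)"
    proof (rule inj_onI)
      fix y z assume yz: "y \<in> E \<times> UNIV" "z \<in> E \<times> UNIV" "D y = D z"
      obtain e b x where y: "y = (e, b, x)" "e \<in> E" using yz by auto
      obtain e' b' x' where z: "z = (e', b', x')" "e' \<in> E" using yz by auto
      have "x = x'" "b = b'"
        using D_c[OF y(2)] D_c[OF z(2)] D_plus[OF y(2)] D_plus[OF z(2)] yz(3) y z by metis+
      thus "y = z" using D_inj yz(3) y z by blast
    qed
    have img: "d \<in> D ` (E \<times> UNIV)" if d: "d \<in> darts H" "?c d = FarUV" for d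
    proof (cases "?plus d")
      case True
      hence "d = D (d, True, FarUV)" "d \<in> E" using d by (simp_all add: D E_def)
      thus ?thesis by blast
    next
      case False
      hence "d = D (?f d, False, FarUV)" "?f d \<in> E"
        using d by (simp_all add: D E_def ff fc f_in plus_f)
      thus ?thesis by blast
    qed
    have preimage: "d \<in> D ` (E \<times> UNIV)" if d: "d \<in> darts H" "?n d \<in> D ` (E \<times> UNIV)" for d
    proof -
      obtain y where y: "y \<in> E \<times> UNIV" "?n d = D y" using d(2) by auto
      have y': "side_next y \<in> E \<times> UNIV" using y(1) by (simp only: side_next_in)
      have "d = ?n (?n (?n d))" using n3[OF d(1)] by simp
      also have "\<dots> = D (side_next (side_next y))" using y(2) nxt[OF y(1)] nxt[OF y'] by simp
      finally show ?thesis using y' by (metis image_eqI side_next_in)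
    qed
    have "d \<in> D ` (E \<times> UNIV)" if d: "d \<in> darts H" for d
    proof -
      have d': "?n d \<in> darts H" "?n (?n d) \<in> darts H" using d by (simp_all add: n_in)
      have "?c d = FarUV \<or> ?c (?n d) = FarUV \<or> ?c (?n (?n d)) = FarUV"
        using d by (cases "?c d") (auto simp: nc n_in face_n)
      thus ?thesis using img preimage d d' by blast
    qed
    thus "D ` (E \<times> UNIV) = darts H" using D_in by auto
  qed
  hence "surface_chart H E p q (\<lambda>e. chamber_color H (D ` ({e} \<times> UNIV))) D"
    by unfold_locales (use finE p q rot flip nxt flp D_c in auto)
  thus ?thesis by blast
qed

section \<open>Factorizations belonging to one surface\<close>

text \<open>
  By the next two lemmas, two surfaces are isomorphic if and only if their chambers can be labelled
  by the same set with the same permutations and colors.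
\<close>
lemma surface_isos_transfer_chart:
  fixes H :: "'d surface" and H' :: "'g surface"
  assumes chart: "surface_chart H A p q c D" and H': "checker_surface H'"
    and iso: "surface_isos H H' \<noteq> {}"
  shows "\<exists>D'. surface_chart H' A p q c D'"
proof -
  obtain E' :: "'g set" and p' q' c' D' where chart': "surface_chart H' E' p' q' c' D'"
    using exists_chart[OF H'] by blast
  interpret surface_chart H A p q c D by fact
  obtain \<phi> where \<phi>: "\<phi> \<in> pair_isos A c p q E' c' p' q'"
    using iso bij_betw_chart_map[OF chart chart'] unfolding bij_betw_def by blast
  show ?thesis using surface_chart.rechart[OF chart' \<phi> p q] by blast
qed

lemma surface_isos_same_chart:
  assumes chart: "surface_chart H A p q c D" and chart': "surface_chart H' A p q c D'"
  shows "surface_isos H H' \<noteq> {}"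
proof -
  interpret surface_chart H A p q c D by fact
  have "restrict id A \<in> pair_isos A c p q A c p q"
    using permutes_in_image[OF p] permutes_in_image[OF q]
    by (auto simp: pair_isos_def perm_isos_def bij_betw_def inj_on_def)
  thus ?thesis using bij_betw_chart_map[OF chart chart'] unfolding bij_betw_def by blast
qed

lemma finite_perm_isos: "finite A \<Longrightarrow> finite B \<Longrightarrow> finite (perm_isos A c g B d h)"
  by (rule finite_subset[of _ "A \<rightarrow>\<^sub>E B"]) (auto simp: perm_isos_def intro: finite_PiE)

text \<open>
  A labelling of the chambers of \<open>H\<close> by the colored set \<open>A\<close> turns the three types of
  vertices into the cycles of permutations \<open>q\<close>, \<open>p\<close> and \<open>p \<circ> q\<close> of \<open>A\<close>. If the last one
  is \<open>g\<close>, the labelling has produced a factorization of \<open>g\<close>; different labellings can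
  produce the same one.
\<close>
definition surface_factorizations ::
  "'d surface \<Rightarrow> 'a set \<Rightarrow> ('a \<Rightarrow> nat) \<Rightarrow> ('a \<Rightarrow> 'a) \<Rightarrow> (('a \<Rightarrow> 'a) \<times> ('a \<Rightarrow> 'a)) set" where
  "surface_factorizations H A c g = {(p, q). p \<circ> q = g \<and> (\<exists>D. surface_chart H A p q c D)}"

lemma surface_factorizations_permutes:
  "(p, q) \<in> surface_factorizations H A c g \<Longrightarrow> p permutes A \<and> q permutes A"
  using surface_chart.p surface_chart.q unfolding surface_factorizations_def by blast

lemma perm_isos_pull_back:
  assumes \<phi>: "bij_betw \<phi> A E" and p: "p permutes E"
  shows "restrict_id (inv_into A \<phi> \<circ> p \<circ> \<phi>) A permutes A"
    and "a \<in> A \<Longrightarrow> \<phi> (restrict_id (inv_into A \<phi> \<circ> p \<circ> \<phi>) A a) = p (\<phi> a)"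
proof -
  have "bij_betw (inv_into A \<phi> \<circ> p \<circ> \<phi>) A A"
    by (intro bij_betw_trans[OF \<phi>] bij_betw_trans[OF permutes_imp_bij[OF p]] bij_betw_inv_into \<phi>
        | simp only: comp_assoc)+
  thus "restrict_id (inv_into A \<phi> \<circ> p \<circ> \<phi>) A permutes A" by (rule permutes_restrict_id)
  show "\<phi> (restrict_id (inv_into A \<phi> \<circ> p \<circ> \<phi>) A a) = p (\<phi> a)" if "a \<in> A"
  proof -
    have "p (\<phi> a) \<in> \<phi> ` A" using that \<phi> permutes_in_image[OF p] by (auto simp: bij_betw_def)
    thus ?thesis using that by (simp add: f_inv_into_f)
  qed
qed

text \<open>
  Let \<open>p0\<close>, \<open>q0\<close> be the permutations of the chambers of \<open>H\<close>. Isomorphisms from \<open>g\<close> to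
  \<open>p0 \<circ> q0\<close> are counted in two ways. There are \<open>#Aut(\<nu>)\<close> of them, because both have
  the neck mess \<open>\<nu>\<close>. On the other hand, each of them is a labelling of the chambers and so pulls the
  pair \<open>p0\<close>, \<open>q0\<close> back to a factorization of \<open>g\<close>; the isomorphisms giving a fixed
  factorization are those of the pairs of permutations, which correspond to the automorphisms
  of \<open>H\<close>.
\<close>
lemma card_surface_factorizations:
  fixes H :: "'d surface"
  assumes chart: "surface_chart H E p0 q0 c0 D0" and A: "finite A" and g: "g permutes A"
    and mess: "cycle_neck_mess E c0 (p0 \<circ> q0) = \<nu>" "cycle_neck_mess A c g = \<nu>"
  shows "card (surface_factorizations H A c g) * card (surface_auts H) = card (neck_mess_auts \<nu>)"
    and "surface_factorizations H A c g \<noteq> {}"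
proof -
  interpret h: surface_chart H E p0 q0 c0 D0 by fact
  let ?T = "surface_factorizations H A c g" and ?\<Phi> = "perm_isos A c g E c0 (p0 \<circ> q0)"
  let ?I = "\<lambda>(p, q). pair_isos A c p q E c0 p0 q0"
  have pq0: "(p0 \<circ> q0) permutes E" by (rule permutes_compose[OF h.q h.p])
  have un: "?\<Phi> = (\<Union>t\<in>?T. ?I t)"
  proof (intro equalityI subsetI)
    fix \<phi> assume \<phi>: "\<phi> \<in> ?\<Phi>"
    hence b: "bij_betw \<phi> A E" by (simp add: perm_isos_def)
    define p q where "p = restrict_id (inv_into A \<phi> \<circ> p0 \<circ> \<phi>) A"
      and "q = restrict_id (inv_into A \<phi> \<circ> q0 \<circ> \<phi>) A"
    have p: "p permutes A" "\<And>a. a \<in> A \<Longrightarrow> \<phi> (p a) = p0 (\<phi> a)"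
      unfolding p_def using perm_isos_pull_back[OF b h.p] by auto
    have q: "q permutes A" "\<And>a. a \<in> A \<Longrightarrow> \<phi> (q a) = q0 (\<phi> a)"
      unfolding q_def using perm_isos_pull_back[OF b h.q] by auto
    have iso: "\<phi> \<in> pair_isos A c p q E c0 p0 q0"
      using \<phi> p q by (simp add: pair_isos_def perm_isos_def)
    have "(p \<circ> q) a = g a" for a
    proof (cases "a \<in> A")
      case True
      have in_A: "q a \<in> A" "p (q a) \<in> A" "g a \<in> A"
        using True permutes_in_image[OF p(1)] permutes_in_image[OF q(1)] permutes_in_image[OF g]
        by simp_all
      have "\<phi> (p (q a)) = \<phi> (g a)"
        using p(2)[OF in_A(1)] q(2)[OF True] \<phi> True by (simp add: perm_isos_def)
      thus ?thesis using b in_A by (auto simp: bij_betw_def dest: inj_onD)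
    next
      case False
      thus ?thesis using permutes_not_in[OF p(1)] permutes_not_in[OF q(1)] permutes_not_in[OF g]
        by simp
    qed
    hence "p \<circ> q = g" by auto
    hence "(p, q) \<in> ?T"
      using h.rechart[OF iso p(1) q(1)] by (auto simp: surface_factorizations_def)
    thus "\<phi> \<in> (\<Union>t\<in>?T. ?I t)" using iso by blast
  next
    fix \<phi> assume "\<phi> \<in> (\<Union>t\<in>?T. ?I t)"
    then obtain p q where T: "(p, q) \<in> ?T" and iso: "\<phi> \<in> pair_isos A c p q E c0 p0 q0" by auto
    have "g a = p (q a)" for a using T by (auto simp: surface_factorizations_def)
    moreover have "q a \<in> A" if "a \<in> A" for a
      using surface_factorizations_permutes[OF T] that permutes_in_image[of q A a] by simp
    ultimately show "\<phi> \<in> ?\<Phi>" using iso by (simp add: pair_isos_def perm_isos_def)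
  qed
  have "(p, q) = (p', q')"
    if "(p, q) \<in> ?T" "(p', q') \<in> ?T" "\<phi> \<in> ?I (p, q)" "\<phi> \<in> ?I (p', q')" for p q p' q' \<phi>
  proof -
    note perms = surface_factorizations_permutes[OF that(1)] surface_factorizations_permutes[OF that(2)]
    have inj: "inj_on \<phi> A" using that(3) by (simp add: pair_isos_def perm_isos_def bij_betw_def)
    have eq: "r = r'" if "r permutes A" "r' permutes A" "\<And>a. a \<in> A \<Longrightarrow> \<phi> (r a) = \<phi> (r' a)" for r r'
    proof
      show "r a = r' a" for a
        using inj_onD[OF inj that(3)[of a]] permutes_in_image[OF that(1)] permutes_in_image[OF that(2)]
          permutes_not_in[OF that(1)] permutes_not_in[OF that(2)] by (cases "a \<in> A") auto
    qed
    show ?thesis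
      using eq[of p p'] eq[of q q'] perms that(3,4) by (simp add: pair_isos_def perm_isos_def)
  qed
  hence disj: "?I s \<inter> ?I t = {}" if "s \<in> ?T" "t \<in> ?T" "s \<noteq> t" for s t
    using that by (cases s; cases t) blast
  have finT: "finite ?T"
    by (rule finite_subset[of _ "{p. p permutes A} \<times> {q. q permutes A}"])
      (auto dest: surface_factorizations_permutes simp: finite_permutations[OF A])
  have fin\<Phi>: "finite ?\<Phi>" by (rule finite_perm_isos[OF A h.E])
  have cardI: "card (?I t) = card (surface_auts H)" if "t \<in> ?T" for t
    using that bij_betw_same_card[OF bij_betw_chart_map[OF _ chart]]
    by (auto simp: surface_factorizations_def)
  have "card ?\<Phi> = (\<Sum>t\<in>?T. card (?I t))"
    unfolding un using finT disj finite_subset[OF _ fin\<Phi>[unfolded un]]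
    by (intro card_UN_disjoint) blast+
  also have "\<dots> = card ?T * card (surface_auts H)" using cardI by simp
  finally show "card ?T * card (surface_auts H) = card (neck_mess_auts \<nu>)"
    using card_perm_isos[OF A g mess(2) h.E pq0 mess(1)] by simp
  show "?T \<noteq> {}"
    using perm_isos_nonempty[OF A g mess(2) h.E pq0 mess(1)] un by auto
qed

section \<open>Counting factorizations by surfaces\<close>

lemma equiv_surface_iso:
  fixes W :: "'d surface set"
  assumes "\<And>H. H \<in> W \<Longrightarrow> checker_surface H"
  shows "equiv W {(H, H'). H \<in> W \<and> H' \<in> W \<and> surface_isos H H' \<noteq> {}}"
proof (rule equivI)
  have step: "surface_isos H' H'' \<noteq> {}"
    if W: "H \<in> W" "H' \<in> W" "H'' \<in> W"
      and iso: "surface_isos H H' \<noteq> {}" "surface_isos H H'' \<noteq> {}" for H H' H''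
  proof -
    obtain E :: "'d set" and p q c D where H: "surface_chart H E p q c D"
      using exists_chart[OF assms[OF W(1)]] by blast
    obtain D' where "surface_chart H' E p q c D'"
      using surface_isos_transfer_chart[OF H assms[OF W(2)] iso(1)] by blast
    moreover obtain D'' where "surface_chart H'' E p q c D''"
      using surface_isos_transfer_chart[OF H assms[OF W(3)] iso(2)] by blast
    ultimately show ?thesis by (rule surface_isos_same_chart)
  qed
  have refl: "surface_isos H H \<noteq> {}" if "H \<in> W" for H
    using exists_chart[of H] assms that surface_isos_same_chart by blast
  show "refl_on W {(H, H'). H \<in> W \<and> H' \<in> W \<and> surface_isos H H' \<noteq> {}}"
    using refl by (auto simp: refl_on_def)
  have sym: "surface_isos H' H \<noteq> {}" if "H \<in> W" "H' \<in> W" "surface_isos H H' \<noteq> {}" for H H'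
    by (rule step[OF that(1,2,1,3) refl[OF that(1)]])
  show "sym {(H, H'). H \<in> W \<and> H' \<in> W \<and> surface_isos H H' \<noteq> {}}"
    using sym by (auto simp: sym_def)
  show "trans {(H, H'). H \<in> W \<and> H' \<in> W \<and> surface_isos H H' \<noteq> {}}"
    unfolding trans_def using step[OF _ _ _ sym] by auto
qed auto

text \<open>
  Each factorization \<open>g = p \<circ> q\<close> is the gluing pattern of exactly one surface up to isomorphism. So
  the factorizations with the prescribed neck messes split into the classes belonging to the
  individual surfaces, and by the double count above the surface \<open>H\<close> accounts for
  \<open>#Aut(\<nu>) / #Aut(H)\<close> of them.
\<close>
lemma card_factorizations_eq_hurwitz:
  fixes A :: "'a set" and c :: "'a \<Rightarrow> nat"
  assumes A: "finite A" and g: "g permutes A"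
    and c: "card A = (\<Sum>j=1..\<psi>. m j)" "c ` A \<subseteq> {1..\<psi>}" "\<forall>j\<in>{1..\<psi>}. card {a \<in> A. c a = j} = m j"
  shows "of_nat (card {(p, q). p permutes A \<and> q permutes A \<and> p \<circ> q = g \<and>
           cycle_neck_mess A c p = \<mu> \<and> cycle_neck_mess A c q = lam}) =
         hurwitz \<psi> m \<mu> lam (cycle_neck_mess A c g)"
proof -
  define \<nu> where "\<nu> = cycle_neck_mess A c g"
  define W where "W = surfaces_with \<psi> m lam \<mu> \<nu>"
  define R where "R = {(H, H'). H \<in> W \<and> H' \<in> W \<and> surface_isos H H' \<noteq> {}}"
  define T where "T = {(p, q). p permutes A \<and> q permutes A \<and> p \<circ> q = g \<and>
    cycle_neck_mess A c p = \<mu> \<and> cycle_neck_mess A c q = lam}"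
  let ?F = "\<lambda>H. surface_factorizations H A c g"
  define rep where "rep K = (SOME H. H \<in> K)" for K :: "nat surface set"
  have checker: "checker_surface H" if "H \<in> W" for H
    using that by (simp add: W_def surfaces_with_def colored_checker_surface_def)
  have equiv: "equiv W R" unfolding R_def by (rule equiv_surface_iso[OF checker])
  have rep: "rep K \<in> K" "rep K \<in> W" if "K \<in> W // R" for K
  proof -
    show "rep K \<in> K"
      unfolding rep_def using in_quotient_imp_non_empty[OF equiv that] by (simp add: some_in_eq)
    thus "rep K \<in> W" using in_quotient_imp_subset[OF equiv that] by blast
  qed
  have finT: "finite T"
    by (rule finite_subset[of _ "{p. p permutes A} \<times> {q. q permutes A}"])
      (use finite_permutations[OF A] in \<open>auto simp: T_def\<close>)
  have F: "card (?F H) * card (surface_auts H) = card (neck_mess_auts \<nu>)" "?F H \<noteq> {}" "?F H \<subseteq> T"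
    if H: "H \<in> W" for H
  proof -
    obtain E :: "nat set" and p0 q0 c0 D0 where chart: "surface_chart H E p0 q0 c0 D0"
      using exists_chart[OF checker[OF H]] by blast
    have mess: "near_far_neck_mess H = lam" "mid_far_neck_mess H = \<mu>" "plus_near_mid_neck_mess H = \<nu>"
      using H by (simp_all add: W_def surfaces_with_def)
    have nu: "cycle_neck_mess E c0 (p0 \<circ> q0) = \<nu>"
      using surface_chart.plus_near_mid_neck_mess_eq[OF chart] mess by simp
    show "card (?F H) * card (surface_auts H) = card (neck_mess_auts \<nu>)" "?F H \<noteq> {}"
      by (rule card_surface_factorizations[OF chart A g nu \<nu>_def[symmetric]])+
    show "?F H \<subseteq> T"
    proof
      fix t assume t: "t \<in> ?F H"
      obtain p q where pq: "t = (p, q)" by fastforce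
      obtain D where "surface_chart H A p q c D" using t pq by (auto simp: surface_factorizations_def)
      then interpret surface_chart H A p q c D .
      show "t \<in> T"
        using p q t pq near_far_neck_mess_eq mid_far_neck_mess_eq mess
        by (auto simp: T_def surface_factorizations_def)
    qed
  qed
  have un: "T = (\<Union>K\<in>W // R. ?F (rep K))"
  proof (intro equalityI subsetI)
    fix t assume "t \<in> T"
    then obtain p q where t: "t = (p, q)" "p permutes A" "q permutes A" "p \<circ> q = g"
      "cycle_neck_mess A c p = \<mu>" "cycle_neck_mess A c q = lam" by (auto simp: T_def)
    obtain H :: "nat surface" and D where chart: "surface_chart H A p q c D"
      using exists_surface[OF A t(2,3)] by blast
    interpret surface_chart H A p q c D by fact
    have H: "H \<in> W"
      using colored_checker_surface_iff[of \<psi> m] c t near_far_neck_mess_eq mid_far_neck_mess_eq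
        plus_near_mid_neck_mess_eq
      by (simp add: W_def surfaces_with_def \<nu>_def)
    define K where "K = R `` {H}"
    have K: "K \<in> W // R" unfolding K_def by (rule quotientI[OF H])
    have "(H, rep K) \<in> R" using rep(1)[OF K] by (simp add: K_def)
    hence "\<exists>D. surface_chart (rep K) A p q c D"
      using surface_isos_transfer_chart[OF chart checker[OF rep(2)[OF K]]] by (simp add: R_def)
    hence "t \<in> ?F (rep K)" using t by (simp add: surface_factorizations_def)
    thus "t \<in> (\<Union>K\<in>W // R. ?F (rep K))" using K by blast
  qed (use F(3) rep(2) in blast)
  have disj: "?F (rep K) \<inter> ?F (rep K') = {}" if K: "K \<in> W // R" "K' \<in> W // R" "K \<noteq> K'" for K K'
  proof (rule ccontr)
    assume "?F (rep K) \<inter> ?F (rep K') \<noteq> {}"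
    then obtain p q D D' where "surface_chart (rep K) A p q c D" "surface_chart (rep K') A p q c D'"
      by (auto simp: surface_factorizations_def)
    hence "surface_isos (rep K) (rep K') \<noteq> {}" by (rule surface_isos_same_chart)
    hence "(rep K, rep K') \<in> R"
      using rep(2)[OF K(1)] rep(2)[OF K(2)] by (auto simp: R_def)
    thus False
      using quotient_eqI[OF equiv K(1,2) rep(1)[OF K(1)] rep(1)[OF K(2)]] K(3) by simp
  qed
  \<comment> \<open>Each class has its own nonempty share of the finite set \<open>T\<close>.\<close>
  have finQ: "finite (W // R)"
  proof (rule inj_on_finite[of "\<lambda>K. SOME t. t \<in> ?F (rep K)"])
    have some: "(SOME t. t \<in> ?F (rep K)) \<in> ?F (rep K)" if "K \<in> W // R" for K
      using F(2)[OF rep(2)[OF that]] by (simp add: some_in_eq)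
    show "inj_on (\<lambda>K. SOME t. t \<in> ?F (rep K)) (W // R)"
      by (rule inj_onI) (metis some disj disjoint_iff)
    show "(\<lambda>K. SOME t. t \<in> ?F (rep K)) ` (W // R) \<subseteq> T"
      using some F(3) rep(2) by blast
  qed (rule finT)
  have "card T = (\<Sum>K\<in>W // R. card (?F (rep K)))"
    unfolding un using finQ disj finite_subset[OF _ finT[unfolded un]]
    by (intro card_UN_disjoint) blast+
  hence "(of_nat (card T) :: complex) = (\<Sum>K\<in>W // R. of_nat (card (?F (rep K))))" by simp
  also have "\<dots> = (\<Sum>K\<in>W // R. of_nat (card (neck_mess_auts \<nu>)) * (1 / of_nat (card (surface_auts (rep K)))))"
  proof (rule sum.cong[OF refl])
    fix K assume K: "K \<in> W // R"
    note F = F[OF rep(2)[OF K]]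
    have "surface_auts (rep K) \<noteq> {}"
      using equiv rep(2)[OF K] by (auto simp: R_def equiv_def refl_on_def)
    moreover have "finite (surface_auts (rep K))"
    proof (rule finite_subset)
      show "surface_auts (rep K) \<subseteq> darts (rep K) \<rightarrow>\<^sub>E darts (rep K)" by (auto simp: surface_isos_def)
      have "finite (darts (rep K))" using checker[OF rep(2)[OF K]] by (simp add: checker_surface_def)
      thus "finite (darts (rep K) \<rightarrow>\<^sub>E darts (rep K))" by (simp add: finite_PiE)
    qed
    ultimately have "(of_nat (card (surface_auts (rep K))) :: complex) \<noteq> 0" by simp
    thus "of_nat (card (?F (rep K))) =
        (of_nat (card (neck_mess_auts \<nu>)) * (1 / of_nat (card (surface_auts (rep K)))) :: complex)"
      using F(1) by (simp add: field_simps flip: of_nat_mult)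
  qed
  also have "\<dots> = hurwitz \<psi> m \<mu> lam \<nu>"
    by (simp add: hurwitz_def surface_classes_def sum_distrib_left rep_def R_def W_def)
  finally show ?thesis by (simp add: T_def \<nu>_def)
qed

section \<open>Young conjugacy classes and the multiplication formula\<close>

lemma color_of_eq:
  assumes "disjoint_family_on \<Omega> {1..\<psi>}" and "j \<in> {1..\<psi>}" and "x \<in> \<Omega> j"
  shows "color_of \<Omega> \<psi> x = j"
  unfolding color_of_def
proof (rule the_equality)
  show "k = j" if "k \<in> {1..\<psi>} \<and> x \<in> \<Omega> k" for k
    using disjoint_family_onD[OF assms(1), of k j] that assms(2,3) by auto
qed (use assms in simp)

lemma perm_neck_mess_eq: "perm_neck_mess \<Omega> \<psi> g = cycle_neck_mess (total \<Omega> \<psi>) (color_of \<Omega> \<psi>) g"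
  by (simp add: perm_neck_mess_def cycle_neck_mess_def cycle_necklace_def)

lemma young_iff:
  assumes disj: "disjoint_family_on \<Omega> {1..\<psi>}" and fin: "finite (total \<Omega> \<psi>)"
  shows "h \<in> young \<Omega> \<psi> \<longleftrightarrow> h permutes total \<Omega> \<psi> \<and>
    (\<forall>x\<in>total \<Omega> \<psi>. color_of \<Omega> \<psi> (h x) = color_of \<Omega> \<psi> x)"
proof -
  have mem: "x \<in> \<Omega> j \<longleftrightarrow> x \<in> total \<Omega> \<psi> \<and> color_of \<Omega> \<psi> x = j" if "j \<in> {1..\<psi>}" for x j
    using that color_of_eq[OF disj] by (auto simp: total_def)
  have col: "color_of \<Omega> \<psi> x \<in> {1..\<psi>}" if "x \<in> total \<Omega> \<psi>" for x
    using that color_of_eq[OF disj] by (auto simp: total_def)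
  show ?thesis
  proof (cases "h permutes total \<Omega> \<psi>")
    case True
    have "(\<forall>j\<in>{1..\<psi>}. h ` \<Omega> j = \<Omega> j) \<longleftrightarrow>
        (\<forall>x\<in>total \<Omega> \<psi>. color_of \<Omega> \<psi> (h x) = color_of \<Omega> \<psi> x)"
    proof
      assume L: "\<forall>j\<in>{1..\<psi>}. h ` \<Omega> j = \<Omega> j"
      show "\<forall>x\<in>total \<Omega> \<psi>. color_of \<Omega> \<psi> (h x) = color_of \<Omega> \<psi> x"
        using L mem col by (metis image_eqI)
    next
      assume R: "\<forall>x\<in>total \<Omega> \<psi>. color_of \<Omega> \<psi> (h x) = color_of \<Omega> \<psi> x"
      show "\<forall>j\<in>{1..\<psi>}. h ` \<Omega> j = \<Omega> j"
      proof
        fix j assume j: "j \<in> {1..\<psi>}"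
        have "h ` \<Omega> j \<subseteq> \<Omega> j"
          using R mem[OF j] permutes_in_image[OF True] by auto
        moreover have "finite (\<Omega> j)" using fin j by (auto simp: total_def intro: finite_subset)
        ultimately show "h ` \<Omega> j = \<Omega> j"
          using permutes_inj_on[OF True] by (simp add: endo_inj_surj)
      qed
    qed
    thus ?thesis using True by (simp add: young_def symmetric_def)
  qed (simp add: young_def symmetric_def)
qed

text \<open>
  A conjugation by an element of the Young subgroup is an isomorphism of colored permutations, so two
  permutations are conjugate in this sense precisely if their neck messes agree. Hence the classes
  are the fibers of \<^const>\<open>perm_neck_mess\<close>.
\<close>
lemma young_conjugacy_iff:
  assumes disj: "disjoint_family_on \<Omega> {1..\<psi>}" and fin: "finite (total \<Omega> \<psi>)"
  shows "{(g, h \<circ> g \<circ> inv h) | g h. g \<in> symmetric \<Omega> \<psi> \<and> h \<in> young \<Omega> \<psi>} =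
    {(g, g'). g \<in> symmetric \<Omega> \<psi> \<and> g' \<in> symmetric \<Omega> \<psi> \<and>
      perm_neck_mess \<Omega> \<psi> g = perm_neck_mess \<Omega> \<psi> g'}" (is "?L = ?R")
proof (intro equalityI subsetI)
  let ?A = "total \<Omega> \<psi>" and ?c = "color_of \<Omega> \<psi>"
  fix x assume "x \<in> ?L"
  then obtain g h where x: "x = (g, h \<circ> g \<circ> inv h)" and g: "g permutes ?A" and h: "h \<in> young \<Omega> \<psi>"
    by (auto simp: symmetric_def)
  have h: "h permutes ?A" "\<forall>x\<in>?A. ?c (h x) = ?c x" using h young_iff[OF disj fin] by auto
  have g': "(h \<circ> g \<circ> inv h) permutes ?A"
    by (intro permutes_compose permutes_inv h g)
  have "restrict h ?A \<in> perm_isos ?A ?c g ?A ?c (h \<circ> g \<circ> inv h)"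
    using h permutes_in_image[OF h(1)] permutes_in_image[OF g] permutes_inverses(2)[OF h(1)]
      permutes_imp_bij[OF h(1)]
    by (auto simp: perm_isos_def cong: bij_betw_cong)
  hence "cycle_neck_mess ?A ?c g = cycle_neck_mess ?A ?c (h \<circ> g \<circ> inv h)"
    by (rule cycle_neck_mess_eq[OF _ fin g g'])
  thus "x \<in> ?R" using x g g' by (simp add: symmetric_def perm_neck_mess_eq)
next
  let ?A = "total \<Omega> \<psi>" and ?c = "color_of \<Omega> \<psi>"
  fix x assume "x \<in> ?R"
  then obtain g g' where x: "x = (g, g')" and g: "g permutes ?A" "g' permutes ?A"
    and mess: "cycle_neck_mess ?A ?c g = cycle_neck_mess ?A ?c g'" by (auto simp: symmetric_def perm_neck_mess_eq)
  obtain f where f: "f \<in> perm_isos ?A ?c g ?A ?c g'"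
    using perm_isos_nonempty[OF fin g(1) refl fin g(2) mess[symmetric]] by blast
  define h where "h = restrict_id f ?A"
  have h: "h permutes ?A"
    unfolding h_def using f by (intro permutes_restrict_id) (simp add: perm_isos_def)
  have "h \<in> young \<Omega> \<psi>"
    unfolding young_iff[OF disj fin] using h f by (simp add: h_def perm_isos_def)
  moreover have "h \<circ> g \<circ> inv h = g'"
  proof
    fix y
    have "h (g z) = g' (h z)" for z
    proof (cases "z \<in> ?A")
      case True
      thus ?thesis using f permutes_in_image[OF g(1)] by (simp add: h_def perm_isos_def)
    next
      case False
      thus ?thesis
        using permutes_not_in[OF g(1)] permutes_not_in[OF g(2)] permutes_not_in[OF h] by simp
    qed
    thus "(h \<circ> g \<circ> inv h) y = g' y" using permutes_inverses(1)[OF h] by simp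
  qed
  ultimately show "x \<in> ?L" using x g(1) by (auto simp: symmetric_def)
qed

theorem theorem5:
  fixes \<Omega> :: "nat \<Rightarrow> 'a set" and \<psi> :: nat and m :: "nat \<Rightarrow> nat"
    and lam \<mu> :: neck_mess
  assumes "\<And>j. j \<in> {1..\<psi>} \<Longrightarrow> finite (\<Omega> j) \<and> card (\<Omega> j) = m j"
    and "disjoint_family_on \<Omega> {1..\<psi>}"
    and "lam \<in> neck_messes \<psi> m"
    and "\<mu> \<in> neck_messes \<psi> m"
  shows "convolution \<Omega> \<psi> (gamma \<Omega> \<psi> \<mu>) (gamma \<Omega> \<psi> lam) =
    (\<lambda>g. \<Sum>\<nu>\<in>young_classes \<Omega> \<psi>.
       hurwitz \<psi> m \<mu> lam (class_neck_mess \<Omega> \<psi> \<nu>) * gamma \<Omega> \<psi> (class_neck_mess \<Omega> \<psi> \<nu>) g)"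
proof
  fix g :: "'a \<Rightarrow> 'a"
  let ?A = "total \<Omega> \<psi>" and ?c = "color_of \<Omega> \<psi>" and ?S = "symmetric \<Omega> \<psi>"
  let ?mess = "perm_neck_mess \<Omega> \<psi>" and ?cnm = "class_neck_mess \<Omega> \<psi>"
  note disj = assms(2)
  have fin: "finite ?A" using assms(1) by (simp add: total_def)
  have finS: "finite ?S" unfolding symmetric_def by (rule finite_permutations[OF fin])
  have fiber: "{a \<in> ?A. ?c a = j} = \<Omega> j" if "j \<in> {1..\<psi>}" for j
    using that color_of_eq[OF disj] by (auto simp: total_def)
  have cardA: "card ?A = (\<Sum>j=1..\<psi>. m j)"
    unfolding total_def using assms(1) disj
    by (subst card_UN_disjoint') auto
  have colors: "?c ` ?A \<subseteq> {1..\<psi>}" "\<forall>j\<in>{1..\<psi>}. card {a \<in> ?A. ?c a = j} = m j"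
    using color_of_eq[OF disj] fiber assms(1) by (auto simp: total_def)
  define r where "r = {(g, g'). g \<in> ?S \<and> g' \<in> ?S \<and> ?mess g = ?mess g'}"
  have classes: "young_classes \<Omega> \<psi> = ?S // r"
    unfolding young_classes_def young_conjugacy_iff[OF disj fin] r_def ..
  have cnm: "?cnm (r `` {g}) = ?mess g" if "g \<in> ?S" for g
    unfolding class_neck_mess_def by (rule the_equality) (use that in \<open>auto simp: r_def\<close>)
  let ?rhs = "\<Sum>\<nu>\<in>young_classes \<Omega> \<psi>. hurwitz \<psi> m \<mu> lam (?cnm \<nu>) * gamma \<Omega> \<psi> (?cnm \<nu>) g"
  show "convolution \<Omega> \<psi> (gamma \<Omega> \<psi> \<mu>) (gamma \<Omega> \<psi> lam) g = ?rhs"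
  proof (cases "g \<in> ?S")
    case True
    let ?P = "{(p, q). p \<in> ?S \<and> q \<in> ?S \<and> p \<circ> q = g}"
    let ?T = "{(p, q). p permutes ?A \<and> q permutes ?A \<and> p \<circ> q = g \<and>
      cycle_neck_mess ?A ?c p = \<mu> \<and> cycle_neck_mess ?A ?c q = lam}"
    have finP: "finite ?P"
      by (rule finite_subset[of _ "?S \<times> ?S"]) (use finS in auto)
    \<comment> \<open>The coefficient of \<open>g\<close> in the product counts the factorizations \<open>g = p \<circ> q\<close> in the set \<open>?T\<close>.\<close>
    have T: "?T = {t \<in> ?P. t \<in> ?T}" by (auto simp: symmetric_def)
    have "convolution \<Omega> \<psi> (gamma \<Omega> \<psi> \<mu>) (gamma \<Omega> \<psi> lam) g = (\<Sum>t\<in>?P. of_bool (t \<in> ?T))"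
      unfolding convolution_def
      by (rule sum.cong) (auto simp: gamma_def Gamma_def symmetric_def perm_neck_mess_eq)
    also have "\<dots> = of_nat (card {t \<in> ?P. t \<in> ?T})"
      using finP by (simp add: Int_def)
    also have "\<dots> = of_nat (card ?T)" using T by presburger
    also have "\<dots> = hurwitz \<psi> m \<mu> lam (?mess g)"
      unfolding perm_neck_mess_eq
      using card_factorizations_eq_hurwitz[OF fin _ cardA colors] True by (simp add: symmetric_def)
    also have "\<dots> = ?rhs"
    proof -
      \<comment> \<open>Different classes have different neck messes, so only that of \<open>g\<close> contributes.\<close>
      have in_cl: "r `` {g} \<in> ?S // r" by (rule quotientI[OF True])
      have "gamma \<Omega> \<psi> (?cnm C) g = 0" if C: "C \<in> ?S // r - {r `` {g}}" for C
      proof -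
        obtain g' where g': "g' \<in> ?S" "C = r `` {g'}" using C by (auto elim: quotientE)
        have "?mess g' \<noteq> ?mess g" using C g' True by (auto simp: r_def)
        thus ?thesis using cnm[OF g'(1)] g'(2) by (simp add: gamma_def Gamma_def)
      qed
      moreover have "gamma \<Omega> \<psi> (?cnm (r `` {g})) g = 1"
        using True cnm[OF True] by (simp add: gamma_def Gamma_def)
      moreover have "finite (?S // r)" using finS by (simp add: quotient_def)
      ultimately show ?thesis
        unfolding classes using in_cl cnm[OF True] by (simp add: sum.remove)
    qed
    finally show ?thesis .
  next
    case False
    have "p \<circ> q \<in> ?S" if "p \<in> ?S" "q \<in> ?S" for p q
      using that by (auto simp: symmetric_def intro: permutes_compose)
    hence empty: "{(p, q). p \<in> ?S \<and> q \<in> ?S \<and> p \<circ> q = g} = {}" using False by auto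
    have "convolution \<Omega> \<psi> (gamma \<Omega> \<psi> \<mu>) (gamma \<Omega> \<psi> lam) g = 0"
      by (simp only: convolution_def empty sum.empty)
    moreover have "gamma \<Omega> \<psi> \<theta> g = 0" for \<theta> using False by (simp add: gamma_def Gamma_def)
    ultimately show ?thesis by simp
  qed
qed

end
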